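(* Let the real data $E,A,B_1,B_2,R_1,R_2,C_1,C_2,Z$, the derived matrices $\hat A,\tilde B,\hat B,\hat R,\hat C,\hat Z$, and the shifts in the open left half-plane grouped into $N$ blocks with representatives $\alpha_1,\dots,\alpha_N$ be as in the context. Let $s_w^{(j)}, l_w^{(j)}, w_j,\tilde x_j, S_w^{(j)},L_w^{(j)},W^{(j)},\tilde X^{(j)},C_\perp^{(j)}$ ($1\le j\le N$) be produced by the recursion in the context, so that $W^{(i)}$ solves $$\hat A^\top W^{(i)}-E^\top W^{(i)}S_w^{(i)}+\hat C^\top\hat Z L_w^{(i)}=0$$ and $$-(S_w^{(i)})^\top(\tilde X^{(i)})^{-1}-(\tilde X^{(i)})^{-1}S_w^{(i)}+(L_w^{(i)})^\top\hat ZL_w^{(i)}+(W^{(i)})^\top\hat B\hat R^{-1}\hat B^\top W^{(i)}=0 .$$ Fix $i\in\{1,\dots,N\}$. Assume that there is a real matrix $V^{(i)}$ with $(W^{(i)})^\top EV^{(i)}=I$, and put $\hat A_r^{(i)}=(W^{(i)})^\top\hat AV^{(i)}$, $A_r^{(i)}=(W^{(i)})^\top AV^{(i)}$, $\hat B_r^{(i)}=(W^{(i)})^\top\hat B=[B_{1,r}^{(i)}\ \ B_{2,r}^{(i)}]$ with $B_{j,r}^{(i)}=(W^{(i)})^\top B_j$, and $\hat C_r^{(i)}=\hat CV^{(i)}=\begin{bmatrix}C_{1,r}^{(i)}\\ C_{2,r}^{(i)}\end{bmatrix}$ with $C_{j,r}^{(i)}=C_jV^{(i)}$, so that $\hat A_r^{(i)}=(S_w^{(i)})^\top-(L_w^{(i)})^\top\hat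 Z\hat C_r^{(i)}$. Suppose that $$\hat C_r^{(i)}=L_w^{(i)}\tilde X^{(i)}=\begin{bmatrix}l_w^{(1)}\tilde x_1&\cdots&l_w^{(i)}\tilde x_i\end{bmatrix}.$$ Then the following hold. 1. $\tilde X^{(i)}$ is a stabilizing solution of the projected Riccati equation $$(\hat A_r^{(i)})^\top\tilde X^{(i)}+\tilde X^{(i)}\hat A_r^{(i)}-\tilde X^{(i)}\hat B_r^{(i)}\hat R^{-1}(\hat B_r^{(i)})^\top\tilde X^{(i)}+(\hat C_r^{(i)})^\top\hat Z\hat C_r^{(i)}=0,$$ that is, it satisfies this equation and the matrix $$\hat A_{\mathrm{cl}}^{(i)}=\hat A_r^{(i)}-\hat B_r^{(i)}\hat R^{-1}(\hat B_r^{(i)})^\top\tilde X^{(i)}=A_r^{(i)}+B_{2,r}^{(i)}R_2^{-1}(B_{2,r}^{(i)})^\top\tilde X^{(i)}-B_{1,r}^{(i)}R_1^{-1}\big((B_{1,r}^{(i)})^\top\tilde X^{(i)}+C_{2,r}^{(i)}\big)$$ is Hurwitz (the second expression for $\hat A_{\mathrm{cl}}^{(i)}$ being part of the claim). Moreover the eigenvalues of $\hat A_{\mathrm{cl}}^{(i)}$ are exactly the shifts belonging to blocks $1,\dots,i$ (a real block $j$ contributing $\alpha_j$, a non-real block $j$ contributing $\alpha_j$ and $\overline{\alpha_j}$), each with algebraic multiplicity $p+m_1$ (multiplicities adding up if shifts are repeated). 2. The residual $$R_s^{(i)}=\hat A^\top\hat X^{(i)}E+E^\top\hat X^{(i)}\hat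 A-E^\top\hat X^{(i)}\hat B\hat R^{-1}\hat B^\top\hat X^{(i)}E+\hat C^\top\hat Z\hat C,\qquad \hat X^{(i)}=W^{(i)}\tilde X^{(i)}(W^{(i)})^\top,$$ satisfies $(V^{(i)})^\top R_s^{(i)}V^{(i)}=0$ and $R_s^{(i)}=(C_\perp^{(i)})^\top\hat ZC_\perp^{(i)}$. 3. The approximation $\tilde K_{\mathrm{gain}}^{(i)}=R_1^{-1}\big(B_1^\top W^{(i)}\tilde X^{(i)}(W^{(i)})^\top E+C_2\big)$ of the gain $K_{\mathrm{gain}}=R_1^{-1}(B_1^\top XE+C_2)$ (obtained by replacing $X$ by $\hat X^{(i)}$) satisfies the recursion $$\tilde K_{\mathrm{gain}}^{(i)}=\tilde K_{\mathrm{gain}}^{(i-1)}+R_1^{-1}\big(B_1^\top w_i\tilde x_iw_i^\top E\big),\qquad \tilde K_{\mathrm{gain}}^{(0)}=R_1^{-1}C_2 .$$ 4. $W^{(i)}$ solves the Sylvester equation $$\hat A^\top W^{(i)}-E^\top W^{(i)}(\hat A_r^{(i)})^\top+(C_\perp^{(i)})^\top\hat ZL_w^{(i)}=0 .$$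
   Context: Data. $E,A\in\mathbb R^{n\times n}$, $B_1\in\mathbb R^{n\times m_1}$, $B_2\in\mathbb R^{n\times m_2}$, $C_1\in\mathbb R^{p\times n}$, $C_2\in\mathbb R^{m_1\times n}$; $R_1\in\mathbb R^{m_1\times m_1}$ and $R_2\in\mathbb R^{m_2\times m_2}$ are symmetric and invertible; $Z\in\mathbb R^{p\times p}$ is symmetric (no definiteness of $R_1,R_2,Z$ is required). The underlying Riccati equation, with solution $X$, is $$A^\top XE+E^\top XA+E^\top XB_2R_2^{-1}B_2^\top XE-(E^\top XB_1+C_2^\top)R_1^{-1}(B_1^\top XE+C_2)+C_1^\top ZC_1=0.$$ Derived matrices. $\tilde B=[0\ \ B_1]\in\mathbb R^{n\times(p+m_1)}$ (zero block of size $n\times p$), $\hat B=[B_1\ \ B_2]$, $\hat R=\mathrm{blkdiag}(R_1,-R_2)$, $\hat C=\begin{bmatrix}C_1\\C_2\end{bmatrix}$, $\hat Z=\mathrm{blkdiag}(Z,-R_1^{-1})$, $\hat A=A+\tilde B\hat Z\hat C=A-B_1R_1^{-1}C_2$. With these, the Riccati equation reads $\hat A^\top XE+E^\top X\hat A-E^\top X\hat B\hat R^{-1}\hat B^\top XE+\hat C^\top\hat Z\hat C=0$. Shifts. The ADI shifts lie in $\mathbb C_-=\{z:\mathrm{Re}\,z<0\}$; non-real shifts occur in adjacent complex-conjugate pairs. The list of shifts is split into $N$ blocks, each block being either one real shift or one conjugate pair; $\alpha_i$ denotes the real shift, respectively one chosen member of the pair, of block $i$. All superscripts $(i)$ count blocks.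 Let $q=p+m_1$ and $I_q$ the $q\times q$ identity. If $\alpha_i$ is real: $s_w^{(i)}=-\alpha_iI_q$, $l_w^{(i)}=-I_q$. If $\alpha_i$ is non-real: $$s_w^{(i)}=\begin{bmatrix}-\mathrm{Re}(\alpha_i)I_q&-\mathrm{Im}(\alpha_i)I_q\\ \mathrm{Im}(\alpha_i)I_q&-\mathrm{Re}(\alpha_i)I_q\end{bmatrix},\qquad l_w^{(i)}=\begin{bmatrix}-I_q&0\end{bmatrix}.$$ Recursion. Start from empty $W^{(0)},\tilde X^{(0)},S_w^{(0)},L_w^{(0)}$ and $C_\perp^{(0)}=\hat C$ (terms containing empty matrices are zero). For $i=1,\dots,N$, the real matrix $w_i$ solves $$\Big(\hat A-\hat B\hat R^{-1}\hat B^\top W^{(i-1)}\tilde X^{(i-1)}(W^{(i-1)})^\top E\Big)^\top w_i-E^\top w_is_w^{(i)}+(C_\perp^{(i-1)})^\top\hat Zl_w^{(i)}=0,$$ $\tilde x_i$ is the inverse (assumed to exist) of the unique solution $(\tilde x_i)^{-1}$ of $$-(s_w^{(i)})^\top(\tilde x_i)^{-1}-(\tilde x_i)^{-1}s_w^{(i)}+(l_w^{(i)})^\top\hat Zl_w^{(i)}+w_i^\top\hat B\hat R^{-1}\hat B^\top w_i=0,$$ and $$S_w^{(i)}=\begin{bmatrix}S_w^{(i-1)}&\tilde X^{(i-1)}\big((L_w^{(i-1)})^\top\hat Zl_w^{(i)}+(W^{(i-1)})^\top\hat B\hat R^{-1}\hat B^\top w_i\big)\\0&s_w^{(i)}\end{bmatrix},\quad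 L_w^{(i)}=[L_w^{(i-1)}\ \ l_w^{(i)}],$$ $$W^{(i)}=[W^{(i-1)}\ \ w_i],\quad \tilde X^{(i)}=\mathrm{blkdiag}(\tilde X^{(i-1)},\tilde x_i),\quad C_\perp^{(i)}=\hat C-L_w^{(i)}\tilde X^{(i)}(W^{(i)})^\top E=C_\perp^{(i-1)}-l_w^{(i)}\tilde x_iw_i^\top E.$$ A matrix is Hurwitz if all its eigenvalues have negative real part. *)

theory Defs
  imports "Jordan_Normal_Form.Spectral_Radius" "HOL-Library.Multiset"
begin

definition append_cols :: "'a :: zero mat \<Rightarrow> 'a mat \<Rightarrow> 'a mat" where
  "append_cols A B = four_block_mat A B (0\<^sub>m 0 (dim_col A)) (0\<^sub>m 0 (dim_col B))"

(* The row count is explicit because the empty list gives the nr x 0 matrix. *)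
definition concat_cols :: "nat \<Rightarrow> 'a :: zero mat list \<Rightarrow> 'a mat" where
  "concat_cols nr Ms = foldl append_cols (0\<^sub>m nr 0) Ms"

(* Unspecified for singular matrices; used only on invertible ones. *)
definition minv :: "'a :: field mat \<Rightarrow> 'a mat" where
  "minv A = the (mat_inverse A)"

(* A block of shifts is encoded by one complex number a: the real shift a,
   or the conjugate pair a, cnj a. *)
definition block_shifts :: "complex \<Rightarrow> complex multiset" where
  "block_shifts a = (if Im a = 0 then {#a#} else {#a, cnj a#})"

definition s_w :: "nat \<Rightarrow> complex \<Rightarrow> real mat" where
  "s_w q a =
    (if Im a = 0 then (- Re a) \<cdot>\<^sub>m 1\<^sub>m q
     else four_block_mat ((- Re a) \<cdot>\<^sub>m 1\<^sub>m q) ((- Im a) \<cdot>\<^sub>m 1\<^sub>m q)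
                         (Im a \<cdot>\<^sub>m 1\<^sub>m q) ((- Re a) \<cdot>\<^sub>m 1\<^sub>m q))"

definition l_w :: "nat \<Rightarrow> complex \<Rightarrow> real mat" where
  "l_w q a =
    (if Im a = 0 then - (1\<^sub>m q) else append_cols (- (1\<^sub>m q)) (0\<^sub>m q q))"

(* Eigenvalues of a real matrix are always those of its complexification. *)
definition complex_spectrum :: "real mat \<Rightarrow> complex set" where
  "complex_spectrum M = spectrum (map_mat complex_of_real M)"

definition alg_mult :: "real mat \<Rightarrow> complex \<Rightarrow> nat" where
  "alg_mult M z = order z (char_poly (map_mat complex_of_real M))"

definition hurwitz :: "real mat \<Rightarrow> bool" where
  "hurwitz M \<longleftrightarrow> (\<forall>z \<in> complex_spectrum M. Re z < 0)"

definition gain :: "real mat \<Rightarrow> real mat \<Rightarrow> real mat \<Rightarrow> real mat \<Rightarrow> real mat \<Rightarrow> real mat" where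
  "gain E B1 C2 R1 X = minv R1 * (B1\<^sup>T * X * E + C2)"

end

theory Submission
  imports Defs
begin

text \<open>
  Everything rests on the pair of equations satisfied by \<open>W\<close>, \<open>S\<close>, \<open>L\<close> and the inverse \<open>P\<close> of
  \<open>X\<close>: a Sylvester equation for \<open>W\<close> and a Lyapunov equation for \<open>P\<close>. One recursion step borders all matrices by a
  block, and the off-diagonal block of the new \<open>S\<close> is exactly what makes both equations survive.
  The matrix \<open>X\<close> is symmetric because the Lyapunov operator of a shift block is injective.

  Multiplying the Lyapunov equation by \<open>X\<close> on both sides gives a quadratic equation for \<open>X\<close>, which
  together with the Sylvester equation factorizes the residual. Multiplying it by \<open>X\<close> only on
  the right shows that the closed-loop matrix is \<open>- P S X\<close>, hence similar to \<open>- S\<close>; the latter is block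
  triangular with diagonal blocks \<open>- s_w\<close>, whose eigenvalues are the shifts.
\<close>

section \<open>Matrix algebra\<close>

text \<open>
  The library versions of these laws have carrier premises whose inner dimension does not occur in
  the conclusion, so they cannot be used as conditional rewrite rules; those below can.
\<close>

lemma mat_mult_assoc_dim:
  fixes A B C :: "'a :: semiring_0 mat"
  assumes "dim_col A = dim_row B" "dim_col B = dim_row C"
  shows "A * B * C = A * (B * C)"
  using assms by (intro assoc_mult_mat) auto

lemma mat_add_mult_dim:
  fixes A B C :: "'a :: semiring_0 mat"
  assumes "dim_row A = dim_row B" "dim_col A = dim_col B" "dim_col B = dim_row C"
  shows "(A + B) * C = A * C + B * C"
  using assms by (intro add_mult_distrib_mat) auto

lemma mat_mult_add_dim:
  fixes A B C :: "'a :: semiring_0 mat"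
  assumes "dim_row B = dim_row C" "dim_col B = dim_col C" "dim_col A = dim_row B"
  shows "A * (B + C) = A * B + A * C"
  using assms by (intro mult_add_distrib_mat) auto

lemma mat_minus_mult_dim:
  fixes A B C :: "'a :: ring mat"
  assumes "dim_row A = dim_row B" "dim_col A = dim_col B" "dim_col B = dim_row C"
  shows "(A - B) * C = A * C - B * C"
  using assms by (intro minus_mult_distrib_mat) auto

lemma mat_mult_minus_dim:
  fixes A B C :: "'a :: ring mat"
  assumes "dim_row B = dim_row C" "dim_col B = dim_col C" "dim_col A = dim_row B"
  shows "A * (B - C) = A * B - A * C"
  using assms by (intro mult_minus_distrib_mat) auto

lemma mat_transpose_mult_dim:
  fixes A B :: "'a :: comm_semiring_0 mat"
  assumes "dim_col A = dim_row B"
  shows "(A * B)\<^sup>T = B\<^sup>T * A\<^sup>T"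
  using assms by (intro transpose_mult) auto

lemma mat_transpose_add_dim:
  assumes "dim_row A = dim_row B" "dim_col A = dim_col B"
  shows "(A + B)\<^sup>T = A\<^sup>T + B\<^sup>T"
  using assms by (intro eq_matI) auto

lemma mat_transpose_minus_dim:
  assumes "dim_row A = dim_row B" "dim_col A = dim_col B"
  shows "(A - B)\<^sup>T = A\<^sup>T - B\<^sup>T"
  using assms by (intro eq_matI) auto

lemma mat_transpose_uminus: "(- A)\<^sup>T = - A\<^sup>T"
  by (intro eq_matI) auto

lemma mat_transpose_smult: "(c \<cdot>\<^sub>m M)\<^sup>T = c \<cdot>\<^sub>m M\<^sup>T"
  by (intro eq_matI) auto

lemma mat_uminus_mult_dim:
  fixes A B :: "'a :: ring mat"
  assumes "dim_col A = dim_row B"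
  shows "(- A) * B = - (A * B)" "A * (- B) = - (A * B)"
  using assms by (auto intro!: uminus_mult_left_mat uminus_mult_right_mat)

lemma mat_one_mult_dim:
  fixes A :: "'a :: semiring_1 mat"
  shows "dim_row A = n \<Longrightarrow> 1\<^sub>m n * A = A" "dim_col A = n \<Longrightarrow> A * 1\<^sub>m n = A"
  by (auto intro!: left_mult_one_mat right_mult_one_mat)

lemma mat_zero_mult_dim:
  fixes A :: "'a :: semiring_0 mat"
  shows "dim_row A = n \<Longrightarrow> 0\<^sub>m k n * A = 0\<^sub>m k (dim_col A)"
    "dim_col A = n \<Longrightarrow> A * 0\<^sub>m n k = 0\<^sub>m (dim_row A) k"
  by (auto intro!: left_mult_zero_mat right_mult_zero_mat)

lemmas mat_algebra =
  mat_mult_assoc_dim mat_add_mult_dim mat_mult_add_dim mat_minus_mult_dim mat_mult_minus_dim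
  mat_transpose_mult_dim mat_transpose_add_dim mat_transpose_minus_dim mat_transpose_uminus
  mat_uminus_mult_dim mat_one_mult_dim mat_zero_mult_dim

text \<open>
  Identities that are linear in matrix products are reduced to entries, with the entries of the
  products kept as atoms for linear arithmetic (hence the deletion of \<open>index_mult_mat(1)\<close> there).
\<close>

lemma mat_entries_eqI:
  assumes "dim_row A = dim_row B" "dim_col A = dim_col B"
    "\<And>i j. i < dim_row B \<Longrightarrow> j < dim_col B \<Longrightarrow> A $$ (i, j) = B $$ (i, j)"
  shows "A = B"
  using assms by auto

lemma mat_eqD: "A = B \<Longrightarrow> A $$ (i,j) = B $$ (i,j)" by simp

section \<open>Inverses of square matrices\<close>

lemma minv_inverse:
  assumes "A \<in> carrier_mat n n" "invertible_mat A"
  shows "minv A \<in> carrier_mat n n" "A * minv A = 1\<^sub>m n" "minv A * A = 1\<^sub>m n"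
proof -
  obtain B where B: "A * B = 1\<^sub>m (dim_row A)" "B * A = 1\<^sub>m (dim_row B)"
    using assms(2) unfolding invertible_mat_def inverts_mat_def by blast
  \<comment> \<open>\<open>invertible_mat\<close> does not fix the size of its witness
    \<open>B\<close>; it is read off from the two products.\<close>
  have "dim_col B = n" using arg_cong[OF B(1), of dim_col] assms(1) by simp
  moreover have "dim_row B = n" using arg_cong[OF B(2), of dim_col] assms(1) by simp
  ultimately have "B \<in> carrier_mat n n" by auto
  \<comment> \<open>\<open>mat_inverse\<close> returns \<open>None\<close> only outside the units of
    the matrix ring, so \<open>the\<close> in \<open>minv\<close> meets a genuine inverse
    here.\<close>
  then have "A \<in> Units (ring_mat TYPE('a) n ())"
    using B assms(1) unfolding Units_def by (auto simp: ring_mat_simps)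
  then obtain C where "mat_inverse A = Some C"
    using mat_inverse(1)[OF assms(1), where b = "()"] by (cases "mat_inverse A") auto
  with mat_inverse(2)[OF assms(1) this]
  show "minv A \<in> carrier_mat n n" "A * minv A = 1\<^sub>m n" "minv A * A = 1\<^sub>m n"
    unfolding minv_def by auto
qed

lemma invertible_matI:
  assumes "A \<in> carrier_mat n n" "B \<in> carrier_mat n n" "A * B = 1\<^sub>m n" "B * A = 1\<^sub>m n"
  shows "invertible_mat A"
  using assms unfolding invertible_mat_def inverts_mat_def by auto

lemma mat_inverse_unique:
  fixes A B C :: "'a :: semiring_1 mat"
  assumes "A \<in> carrier_mat n n" "B \<in> carrier_mat n n" "C \<in> carrier_mat n n"
    "A * B = 1\<^sub>m n" "C * A = 1\<^sub>m n"
  shows "C = B"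
proof -
  have "C = C * (A * B)" using assms by simp
  also have "\<dots> = (C * A) * B" using assms by (intro assoc_mult_mat[symmetric]) auto
  also have "\<dots> = B" using assms by simp
  finally show ?thesis .
qed

lemma minv_eq:
  assumes "A \<in> carrier_mat n n" "B \<in> carrier_mat n n" "A * B = 1\<^sub>m n" "B * A = 1\<^sub>m n"
  shows "minv A = B"
proof -
  note I = minv_inverse[OF assms(1) invertible_matI[OF assms]]
  show ?thesis
    by (rule mat_inverse_unique[OF assms(1,2) I(1) assms(3) I(3)])
qed

text \<open>Transposing \<open>A * minv A = 1\<^sub>m n\<close> exhibits
  \<open>(minv A)\<^sup>T\<close> as a left inverse of the symmetric \<open>A\<close>, and inverses
  are unique.\<close>

lemma minv_transpose:
  assumes "A \<in> carrier_mat n n" "invertible_mat A" "A\<^sup>T = A"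
  shows "(minv A)\<^sup>T = minv A"
proof -
  note I = minv_inverse[OF assms(1,2)]
  have "(minv A)\<^sup>T * A = (A * minv A)\<^sup>T"
    using I(1) assms(1,3) mat_transpose_mult_dim[of A "minv A"] by simp
  then have "(minv A)\<^sup>T * A = 1\<^sub>m n"
    using I by simp
  with I(1) show ?thesis
    by (intro mat_inverse_unique[OF assms(1) I(1) _ I(2)]) auto
qed

section \<open>Block matrices\<close>

lemma append_cols_carrier [simp]:
  "A \<in> carrier_mat nr c \<Longrightarrow> B \<in> carrier_mat nr d \<Longrightarrow> append_cols A B \<in> carrier_mat nr (c + d)"
  unfolding append_cols_def by auto

lemma four_block_index:
  "four_block_mat A B C D = mat (dim_row A + dim_row D) (dim_col A + dim_col D) (\<lambda>(i,j).
    if i < dim_row A then if j < dim_col A then A $$ (i,j) else B $$ (i,j - dim_col A)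
    else if j < dim_col A then C $$ (i - dim_row A, j) else D $$ (i - dim_row A, j - dim_col A))"
  unfolding four_block_mat_def Let_def by (rule eq_matI) auto

text \<open>\<open>append_cols\<close> and \<open>append_rows\<close> are block matrices with empty
  borders; adding or removing such borders lets the rule for block products govern them.\<close>

lemma four_block_mat_empty:
  "A \<in> carrier_mat nr nc \<Longrightarrow> four_block_mat A (0\<^sub>m nr 0) (0\<^sub>m 0 nc) (0\<^sub>m 0 0) = A"
  by (intro eq_matI) auto

lemma mult_append_cols:
  fixes M :: "'a :: semiring_0 mat"
  assumes "M \<in> carrier_mat k nr" "A \<in> carrier_mat nr c" "B \<in> carrier_mat nr d"
  shows "M * append_cols A B = append_cols (M * A) (M * B)"
  using mult_four_block_mat[OF assms(1) zero_carrier_mat[of k 0] zero_carrier_mat[of 0 nr] zero_carrier_mat[of 0 0]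
      assms(2,3) zero_carrier_mat[of 0 c] zero_carrier_mat[of 0 d]] four_block_mat_empty[OF assms(1)]
    assms carrier_matD[OF assms(2)] carrier_matD[OF assms(3)]
  unfolding append_cols_def by simp

lemma append_cols_mult_four_block:
  fixes A :: "'a :: semiring_0 mat"
  assumes "A \<in> carrier_mat nr c" "B \<in> carrier_mat nr d"
    "P \<in> carrier_mat c c'" "Q \<in> carrier_mat c d'" "R \<in> carrier_mat d c'" "T \<in> carrier_mat d d'"
  shows "append_cols A B * four_block_mat P Q R T = append_cols (A * P + B * R) (A * Q + B * T)"
  using mult_four_block_mat[OF assms(1,2) zero_carrier_mat[of 0 c] zero_carrier_mat[of 0 d] assms(3-6)]
    assms(3-6) carrier_matD[OF assms(1)] carrier_matD[OF assms(2)] carrier_matD[OF assms(5)] carrier_matD[OF assms(6)]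
  unfolding append_cols_def by simp

lemma append_cols_mult_append_rows:
  fixes A :: "'a :: semiring_0 mat"
  assumes "A \<in> carrier_mat nr c" "B \<in> carrier_mat nr d"
    "P \<in> carrier_mat c nc" "Q \<in> carrier_mat d nc"
  shows "append_cols A B * (P @\<^sub>r Q) = A * P + B * Q"
proof -
  have "append_cols A B * (P @\<^sub>r Q) = four_block_mat (A * P + B * Q) (0\<^sub>m nr 0) (0\<^sub>m 0 nc) (0\<^sub>m 0 0)"
    using mult_four_block_mat[OF assms(1,2) zero_carrier_mat[of 0 c] zero_carrier_mat[of 0 d]
        assms(3) zero_carrier_mat[of c 0] assms(4) zero_carrier_mat[of d 0]]
      assms carrier_matD[OF assms(1)] carrier_matD[OF assms(2)] carrier_matD[OF assms(3)] carrier_matD[OF assms(4)]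
    unfolding append_cols_def append_rows_def by simp
  also have "\<dots> = A * P + B * Q"
    using assms by (intro four_block_mat_empty) auto
  finally show ?thesis .
qed

lemma append_rows_mult_append_cols:
  fixes A :: "'a :: semiring_0 mat"
  assumes "A \<in> carrier_mat c m" "B \<in> carrier_mat d m"
    "P \<in> carrier_mat m c'" "Q \<in> carrier_mat m d'"
  shows "(A @\<^sub>r B) * append_cols P Q = four_block_mat (A * P) (A * Q) (B * P) (B * Q)"
  using mult_four_block_mat[OF assms(1) zero_carrier_mat[of c 0] assms(2) zero_carrier_mat[of d 0]
      assms(3,4) zero_carrier_mat[of 0 c'] zero_carrier_mat[of 0 d']]
    assms carrier_matD[OF assms(1)] carrier_matD[OF assms(2)] carrier_matD[OF assms(3)] carrier_matD[OF assms(4)]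
  unfolding append_cols_def append_rows_def by simp

lemma append_rows_mult:
  fixes A :: "'a :: semiring_0 mat"
  assumes "A \<in> carrier_mat c m" "B \<in> carrier_mat d m" "M \<in> carrier_mat m k"
  shows "(A @\<^sub>r B) * M = (A * M) @\<^sub>r (B * M)"
proof -
  \<comment> \<open>Empty borders around \<open>M\<close> turn the product into a block product. As
    \<open>M\<close> recurs on the right, the equation is applied once through
    \<open>arg_cong\<close>; as a rewrite rule it would loop.\<close>
  have "M = four_block_mat M (0\<^sub>m m 0) (0\<^sub>m 0 k) (0\<^sub>m 0 0)"
    using assms by (intro eq_matI) auto
  then have "(A @\<^sub>r B) * M = (A @\<^sub>r B) * four_block_mat M (0\<^sub>m m 0) (0\<^sub>m 0 k) (0\<^sub>m 0 0)"
    by (rule arg_cong)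
  also have "\<dots> = (A * M) @\<^sub>r (B * M)"
    using mult_four_block_mat[OF assms(1) zero_carrier_mat[of c 0] assms(2) zero_carrier_mat[of d 0]
      assms(3) zero_carrier_mat[of m 0] zero_carrier_mat[of 0 k] zero_carrier_mat[of 0 0]]
    assms carrier_matD[OF assms(1)] carrier_matD[OF assms(2)] carrier_matD[OF assms(3)]
    unfolding append_rows_def by simp
  finally show ?thesis .
qed

lemma transpose_append_cols:
  assumes "A \<in> carrier_mat nr c" "B \<in> carrier_mat nr d"
  shows "(append_cols A B)\<^sup>T = A\<^sup>T @\<^sub>r B\<^sup>T"
  using assms unfolding append_cols_def append_rows_def
  by (intro eq_matI) (auto simp: four_block_index)

lemma append_cols_quadratic_form:
  fixes A :: "'a :: comm_semiring_0 mat"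
  assumes A: "A \<in> carrier_mat m c" and B: "B \<in> carrier_mat m d" and M: "M \<in> carrier_mat m m"
  shows "(append_cols A B)\<^sup>T * M * append_cols A B
    = four_block_mat (A\<^sup>T * M * A) (A\<^sup>T * M * B) (B\<^sup>T * M * A) (B\<^sup>T * M * B)"
proof -
  have "(append_cols A B)\<^sup>T * M = (A\<^sup>T * M) @\<^sub>r (B\<^sup>T * M)"
    using A B M unfolding transpose_append_cols[OF A B] by (intro append_rows_mult[OF _ _ M]) auto
  moreover have "((A\<^sup>T * M) @\<^sub>r (B\<^sup>T * M)) * append_cols A B
    = four_block_mat (A\<^sup>T * M * A) (A\<^sup>T * M * B) (B\<^sup>T * M * A) (B\<^sup>T * M * B)"
    using A B M by (intro append_rows_mult_append_cols[OF _ _ A B]) auto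
  ultimately show ?thesis by simp
qed

lemma append_cols_add:
  assumes "A \<in> carrier_mat nr c" "B \<in> carrier_mat nr d"
    "A' \<in> carrier_mat nr c" "B' \<in> carrier_mat nr d"
  shows "append_cols A B + append_cols A' B' = append_cols (A + A') (B + B')"
  using assms unfolding append_cols_def
  by (intro eq_matI) (auto simp: four_block_index)

lemma append_cols_minus:
  assumes "A \<in> carrier_mat nr c" "B \<in> carrier_mat nr d"
    "A' \<in> carrier_mat nr c" "B' \<in> carrier_mat nr d"
  shows "append_cols A B - append_cols A' B' = append_cols (A - A') (B - B')"
  using assms unfolding append_cols_def
  by (intro eq_matI) (auto simp: four_block_index)

lemma append_cols_zero: "append_cols (0\<^sub>m nr c) (0\<^sub>m nr d) = 0\<^sub>m nr (c + d)"
  unfolding append_cols_def by (intro eq_matI) auto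

lemma four_block_mat_uminus:
  assumes "dim_row A = dim_row B" "dim_row C = dim_row D" "dim_col A = dim_col C" "dim_col B = dim_col D"
  shows "- four_block_mat A B C D = four_block_mat (- A) (- B) (- C) (- D)"
  using assms by (intro eq_matI) auto

lemma four_block_mat_add:
  assumes "dim_row A = dim_row B" "dim_row C = dim_row D" "dim_col A = dim_col C" "dim_col B = dim_col D"
    "dim_row A' = dim_row A" "dim_col A' = dim_col A" "dim_row B' = dim_row B" "dim_col B' = dim_col B"
    "dim_row C' = dim_row C" "dim_col C' = dim_col C" "dim_row D' = dim_row D" "dim_col D' = dim_col D"
  shows "four_block_mat A B C D + four_block_mat A' B' C' D'
    = four_block_mat (A + A') (B + B') (C + C') (D + D')"
  using assms by (intro eq_matI) auto

lemma four_block_mat_minus: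
  assumes "dim_row A = dim_row B" "dim_row C = dim_row D" "dim_col A = dim_col C" "dim_col B = dim_col D"
    "dim_row A' = dim_row A" "dim_col A' = dim_col A" "dim_row B' = dim_row B" "dim_col B' = dim_col B"
    "dim_row C' = dim_row C" "dim_col C' = dim_col C" "dim_row D' = dim_row D" "dim_col D' = dim_col D"
  shows "four_block_mat A B C D - four_block_mat A' B' C' D'
    = four_block_mat (A - A') (B - B') (C - C') (D - D')"
  using assms by (intro eq_matI) auto

lemma mat_zero_simps:
  fixes A :: "'a :: group_add mat"
  shows "- 0\<^sub>m m k = (0\<^sub>m m k :: 'a mat)"
    "dim_row A = m \<Longrightarrow> dim_col A = k \<Longrightarrow> 0\<^sub>m m k - A = - A"
    "dim_row A = m \<Longrightarrow> dim_col A = k \<Longrightarrow> A - 0\<^sub>m m k = A"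
  by (intro eq_matI; auto)+

lemma diag_block_mat_pair:
  "diag_block_mat [A, B] = four_block_mat A (0\<^sub>m (dim_row A) (dim_col B)) (0\<^sub>m (dim_row B) (dim_col A)) B"
  unfolding diag_block_mat.simps(2)[of A] diag_block_mat_singleton Let_def ..

lemma append_cols_mult_block_diag:
  fixes A :: "'a :: semiring_0 mat"
  assumes "A \<in> carrier_mat nr c" "B \<in> carrier_mat nr d" "P \<in> carrier_mat c c'" "T \<in> carrier_mat d d'"
  shows "append_cols A B * four_block_mat P (0\<^sub>m c d') (0\<^sub>m d c') T = append_cols (A * P) (B * T)"
  unfolding append_cols_mult_four_block[OF assms(1-3) zero_carrier_mat zero_carrier_mat assms(4)]
  using assms by simp

text \<open>Serves two purposes: with \<open>Bhat\<close> and \<open>minv Rhat\<close> it splits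
  \<open>G\<close> into its two parts; with \<open>W\<close> and \<open>X\<close> it isolates the
  increment \<open>w * x * w\<^sup>T\<close> of one recursion step.\<close>

lemma block_diag_sandwich:
  fixes A :: "'a :: comm_semiring_0 mat"
  assumes "A \<in> carrier_mat nr c" "B \<in> carrier_mat nr d" "P \<in> carrier_mat c c" "T \<in> carrier_mat d d"
  shows "append_cols A B * four_block_mat P (0\<^sub>m c d) (0\<^sub>m d c) T * (append_cols A B)\<^sup>T
    = A * P * A\<^sup>T + B * T * B\<^sup>T"
  unfolding append_cols_mult_block_diag[OF assms] transpose_append_cols[OF assms(1,2)]
  using assms by (intro append_cols_mult_append_rows) auto

lemma minv_block_diag:
  assumes A: "A \<in> carrier_mat m m" "invertible_mat A" and B: "B \<in> carrier_mat k k" "invertible_mat B"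
  shows "minv (diag_block_mat [A, - B])
    = four_block_mat (minv A) (0\<^sub>m m k) (0\<^sub>m k m) (- minv B)"
proof -
  note IA = minv_inverse[OF A] and IB = minv_inverse[OF B]
  let ?O = "0\<^sub>m m k :: 'a mat" and ?O' = "0\<^sub>m k m :: 'a mat"
  have O: "?O \<in> carrier_mat m k" "?O' \<in> carrier_mat k m" by auto
  have B': "- B \<in> carrier_mat k k" and IB': "- minv B \<in> carrier_mat k k" using B(1) IB(1) by auto
  have D: "diag_block_mat [A, - B] = four_block_mat A ?O ?O' (- B)"
    unfolding diag_block_mat_pair using A(1) B(1) by simp
  have one: "four_block_mat (1\<^sub>m m) ?O ?O' (1\<^sub>m k) = 1\<^sub>m (m + k)"
    by (intro eq_matI) auto
  have sgn: "(- B) * (- minv B) = 1\<^sub>m k" "(- minv B) * (- B) = 1\<^sub>m k"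
    using B(1) IB by (simp_all add: mat_uminus_mult_dim)
  show ?thesis
    unfolding D
  proof (rule minv_eq)
    show "four_block_mat A ?O ?O' (- B) * four_block_mat (minv A) ?O ?O' (- minv B) = 1\<^sub>m (m + k)"
      unfolding mult_four_block_mat[OF A(1) O B' IA(1) O IB'] one[symmetric] IA(2) sgn
      using A(1) IA(1) B' IB' by (intro cong_four_block_mat) auto
    show "four_block_mat (minv A) ?O ?O' (- minv B) * four_block_mat A ?O ?O' (- B) = 1\<^sub>m (m + k)"
      unfolding mult_four_block_mat[OF IA(1) O IB' A(1) O B'] one[symmetric] IA(3) sgn
      using A(1) IA(1) B' IB' by (intro cong_four_block_mat) auto
  qed (use A(1) IA(1) B' IB' in auto)
qed

section \<open>Lyapunov-Sylvester pairs\<close>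

text \<open>\<open>A\<close>, \<open>G\<close>, \<open>C\<close>, \<open>Z\<close> stand for \<open>Ahat\<close>, \<open>Bhat * minv Rhat * Bhat\<^sup>T\<close>, \<open>Chat\<close>, \<open>Zhat\<close>.\<close>

locale riccati_data =
  fixes n q :: nat and E A G C Z :: "real mat"
  assumes E: "E \<in> carrier_mat n n" and A: "A \<in> carrier_mat n n" and G: "G \<in> carrier_mat n n"
    and C: "C \<in> carrier_mat q n" and Z: "Z \<in> carrier_mat q q"
    and G_sym: "G\<^sup>T = G" and Z_sym: "Z\<^sup>T = Z"

text \<open>The invariant of the recursion. The inverse of \<open>X\<close> is a parameter
  \<open>P\<close> governed by \<open>XP\<close> and \<open>PX\<close>, not \<open>minv X\<close>:
  cancellation becomes rewriting, and a step only has to exhibit the bordered inverse.\<close>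

locale lyapunov_sylvester_pair = riccati_data +
  fixes r :: nat and W X S L P :: "real mat"
  assumes W: "W \<in> carrier_mat n r" and X: "X \<in> carrier_mat r r" and S: "S \<in> carrier_mat r r"
    and L: "L \<in> carrier_mat q r" and P: "P \<in> carrier_mat r r"
    and X_sym: "X\<^sup>T = X" and XP: "X * P = 1\<^sub>m r" and PX: "P * X = 1\<^sub>m r"
    and sylvester: "A\<^sup>T * W - E\<^sup>T * W * S + C\<^sup>T * Z * L = 0\<^sub>m n r"
    and lyapunov: "- (S\<^sup>T * P) - P * S + L\<^sup>T * Z * L + W\<^sup>T * G * W = 0\<^sub>m r r"
begin

lemmas dims = carrier_matD[OF E] carrier_matD[OF A] carrier_matD[OF G] carrier_matD[OF C]
  carrier_matD[OF Z] carrier_matD[OF W] carrier_matD[OF X] carrier_matD[OF S] carrier_matD[OF L]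
  carrier_matD[OF P]

text \<open>Products are normalized to the right, where \<open>X * P\<close> no longer occurs as a
  subterm of \<open>X * (P * M)\<close>; these forms still cancel there.\<close>

lemma X_cancel:
  "dim_row M = r \<Longrightarrow> X * (P * M) = M" "dim_row M = r \<Longrightarrow> P * (X * M) = M"
  using XP PX by (simp_all add: dims mat_mult_assoc_dim[symmetric] mat_one_mult_dim)

lemmas algebra = mat_algebra dims XP PX X_cancel X_sym G_sym Z_sym

lemma inverse_lyapunov:
  "S * X + X * S\<^sup>T = X * L\<^sup>T * Z * L * X + X * W\<^sup>T * G * W * X"
proof -
  have "X * (- (S\<^sup>T * P) - P * S + L\<^sup>T * Z * L + W\<^sup>T * G * W) * X = 0\<^sub>m r r"
    unfolding lyapunov by (simp add: algebra)
  then have "- (X * S\<^sup>T) - S * X + X * (L\<^sup>T * (Z * (L * X))) + X * (W\<^sup>T * (G * (W * X))) = 0\<^sub>m r r"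
    by (simp add: algebra)
  note eq = mat_eqD[OF this]
  show ?thesis
  proof (rule mat_entries_eqI)
    fix i j
    assume "i < dim_row (X * L\<^sup>T * Z * L * X + X * W\<^sup>T * G * W * X)"
      "j < dim_col (X * L\<^sup>T * Z * L * X + X * W\<^sup>T * G * W * X)"
    then show "(S * X + X * S\<^sup>T) $$ (i, j) = (X * L\<^sup>T * Z * L * X + X * W\<^sup>T * G * W * X) $$ (i, j)"
      using eq[of i j] by (simp add: algebra del: index_mult_mat(1))
  qed (simp_all add: dims)
qed

text \<open>\<open>h1\<close> and its transposed counterpart \<open>h2\<close> eliminate
  \<open>A\<close>, leaving \<open>S * X + X * S\<^sup>T\<close> between
  \<open>E\<^sup>T * W\<close> and \<open>W\<^sup>T * E\<close>. By \<open>h3\<close> this yields a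
  term that cancels the one with \<open>G\<close>, and a term in \<open>Z\<close> that completes the
  square.\<close>

lemma residual_factorization:
  "A\<^sup>T * (W * X * W\<^sup>T) * E + E\<^sup>T * (W * X * W\<^sup>T) * A - E\<^sup>T * (W * X * W\<^sup>T) * G * (W * X * W\<^sup>T) * E
     + C\<^sup>T * Z * C = (C - L * X * W\<^sup>T * E)\<^sup>T * Z * (C - L * X * W\<^sup>T * E)"
proof -
  have h1: "(A\<^sup>T * W - E\<^sup>T * W * S + C\<^sup>T * Z * L) * X * W\<^sup>T * E = 0\<^sub>m n n"
    unfolding sylvester by (simp add: algebra)
  have h2: "E\<^sup>T * W * X * (A\<^sup>T * W - E\<^sup>T * W * S + C\<^sup>T * Z * L)\<^sup>T = 0\<^sub>m n n"
    unfolding sylvester by (simp add: algebra)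
  have h3: "E\<^sup>T * W * (S * X + X * S\<^sup>T) * W\<^sup>T * E = E\<^sup>T * W * (X * L\<^sup>T * Z * L * X + X * W\<^sup>T * G * W * X) * W\<^sup>T * E"
    unfolding inverse_lyapunov ..
  show ?thesis (is "?L = ?R")
  proof (rule mat_entries_eqI)
    fix i j
    assume "i < dim_row ?R" "j < dim_col ?R"
    then show "?L $$ (i, j) = ?R $$ (i, j)"
      using mat_eqD[OF h1, of i j] mat_eqD[OF h2, of i j] mat_eqD[OF h3, of i j]
      by (simp add: algebra del: index_mult_mat(1))
  qed (simp_all add: dims)
qed

text \<open>The bordered equations are checked block by block. The old blocks are
  \<open>sylvester\<close> and \<open>lyapunov\<close>, the new diagonal block is
  \<open>lyap\<close>, and the block \<open>X * M\<close> of the new \<open>S\<close> settles the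
  new column and the two off-diagonal blocks.\<close>

lemma extend:
  assumes w: "w \<in> carrier_mat n k" and x: "x \<in> carrier_mat k k" and s: "s \<in> carrier_mat k k"
    and l: "l \<in> carrier_mat q k" and y: "y \<in> carrier_mat k k"
    and x_sym: "x\<^sup>T = x" and xy: "x * y = 1\<^sub>m k" and yx: "y * x = 1\<^sub>m k"
    and step: "(A - G * W * X * W\<^sup>T * E)\<^sup>T * w - E\<^sup>T * w * s + (C - L * X * W\<^sup>T * E)\<^sup>T * Z * l = 0\<^sub>m n k"
    and lyap: "- (s\<^sup>T * y) - y * s + l\<^sup>T * Z * l + w\<^sup>T * G * w = 0\<^sub>m k k"
  defines "M \<equiv> L\<^sup>T * Z * l + W\<^sup>T * G * w"
  shows "lyapunov_sylvester_pair n q E A G C Z (r + k) (append_cols W w)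
    (four_block_mat X (0\<^sub>m r k) (0\<^sub>m k r) x) (four_block_mat S (X * M) (0\<^sub>m k r) s)
    (append_cols L l) (four_block_mat P (0\<^sub>m r k) (0\<^sub>m k r) y)"
proof unfold_locales
  note d = carrier_matD[OF w] carrier_matD[OF x] carrier_matD[OF s] carrier_matD[OF l] carrier_matD[OF y]
  have M: "M \<in> carrier_mat r k" unfolding M_def by (auto simp: dims d)
  let ?O = "0\<^sub>m r k :: real mat" and ?O' = "0\<^sub>m k r :: real mat"
  let ?W = "append_cols W w" and ?L = "append_cols L l"
  let ?S = "four_block_mat S (X * M) ?O' s" and ?P = "four_block_mat P ?O ?O' y"
  have O: "?O \<in> carrier_mat r k" "?O' \<in> carrier_mat k r" by auto
  have XM: "X * M \<in> carrier_mat r k" using X M by auto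
  show "?W \<in> carrier_mat n (r + k)" "?L \<in> carrier_mat q (r + k)"
    "four_block_mat X ?O ?O' x \<in> carrier_mat (r + k) (r + k)"
    "?S \<in> carrier_mat (r + k) (r + k)" "?P \<in> carrier_mat (r + k) (r + k)"
    using W w L l X x S s P y by auto
  show "(four_block_mat X ?O ?O' x)\<^sup>T = four_block_mat X ?O ?O' x"
    by (simp add: transpose_four_block_mat[OF X O x] X_sym x_sym)
  have one: "four_block_mat (1\<^sub>m r) ?O ?O' (1\<^sub>m k) = 1\<^sub>m (r + k)"
    by (intro eq_matI) auto
  show "four_block_mat X ?O ?O' x * ?P = 1\<^sub>m (r + k)"
    unfolding mult_four_block_mat[OF X O x P O y] one[symmetric] XP xy
    using X x P y by (intro cong_four_block_mat) auto
  show "?P * four_block_mat X ?O ?O' x = 1\<^sub>m (r + k)"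
    unfolding mult_four_block_mat[OF P O y X O x] one[symmetric] PX yx
    using X x P y by (intro cong_four_block_mat) auto
  have "A\<^sup>T * ?W - E\<^sup>T * ?W * ?S + C\<^sup>T * Z * ?L
    = append_cols (A\<^sup>T * W - E\<^sup>T * W * S + C\<^sup>T * Z * L)
        (A\<^sup>T * w - (E\<^sup>T * W * (X * M) + E\<^sup>T * w * s) + C\<^sup>T * Z * l)"
  proof -
    have "A\<^sup>T * ?W = append_cols (A\<^sup>T * W) (A\<^sup>T * w)"
      using A W w by (intro mult_append_cols) auto
    moreover have "E\<^sup>T * ?W * ?S = append_cols (E\<^sup>T * W * S) (E\<^sup>T * W * (X * M) + E\<^sup>T * w * s)"
    proof -
      have "E\<^sup>T * ?W = append_cols (E\<^sup>T * W) (E\<^sup>T * w)"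
        using E W w by (intro mult_append_cols) auto
      moreover have "append_cols (E\<^sup>T * W) (E\<^sup>T * w) * ?S
        = append_cols (E\<^sup>T * W * S + E\<^sup>T * w * ?O') (E\<^sup>T * W * (X * M) + E\<^sup>T * w * s)"
        using E W w by (intro append_cols_mult_four_block[OF _ _ S XM O(2) s]) auto
      ultimately show ?thesis using E W S w by simp
    qed
    moreover have "C\<^sup>T * Z * ?L = append_cols (C\<^sup>T * Z * L) (C\<^sup>T * Z * l)"
      using C Z L l by (intro mult_append_cols) auto
    moreover have "append_cols (A\<^sup>T * W) (A\<^sup>T * w)
        - append_cols (E\<^sup>T * W * S) (E\<^sup>T * W * (X * M) + E\<^sup>T * w * s) + append_cols (C\<^sup>T * Z * L) (C\<^sup>T * Z * l)
      = append_cols (A\<^sup>T * W - E\<^sup>T * W * S) (A\<^sup>T * w - (E\<^sup>T * W * (X * M) + E\<^sup>T * w * s))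
        + append_cols (C\<^sup>T * Z * L) (C\<^sup>T * Z * l)"
      using A E W w S s X M by (intro arg_cong2[where f = "(+)"] append_cols_minus) auto
    moreover have "\<dots> = append_cols (A\<^sup>T * W - E\<^sup>T * W * S + C\<^sup>T * Z * L)
        (A\<^sup>T * w - (E\<^sup>T * W * (X * M) + E\<^sup>T * w * s) + C\<^sup>T * Z * l)"
      using A E C Z W w S s X M L l by (intro append_cols_add) auto
    ultimately show ?thesis by simp
  qed
  \<comment> \<open>The contribution \<open>E\<^sup>T * W * (X * M)\<close> is exactly what
    separates \<open>A\<close> from \<open>A - G * W * X * W\<^sup>T * E\<close> and
    \<open>C\<close> from its defect, so the new column is the equation \<open>step\<close>.\<close>
  also have "A\<^sup>T * w - (E\<^sup>T * W * (X * M) + E\<^sup>T * w * s) + C\<^sup>T * Z * l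
     = (A - G * W * X * W\<^sup>T * E)\<^sup>T * w - E\<^sup>T * w * s + (C - L * X * W\<^sup>T * E)\<^sup>T * Z * l" (is "?l = ?r")
  proof (rule mat_entries_eqI)
    fix i j
    assume "i < dim_row ?r" "j < dim_col ?r"
    then show "?l $$ (i, j) = ?r $$ (i, j)"
      by (simp add: algebra d M_def del: index_mult_mat(1))
  qed (simp_all add: dims d)
  finally show "A\<^sup>T * ?W - E\<^sup>T * ?W * ?S + C\<^sup>T * Z * ?L = 0\<^sub>m n (r + k)"
    unfolding sylvester step by (simp add: append_cols_zero)
  have "- (?S\<^sup>T * ?P) - ?P * ?S + ?L\<^sup>T * Z * ?L + ?W\<^sup>T * G * ?W
    = four_block_mat (- (S\<^sup>T * P) - P * S + L\<^sup>T * Z * L + W\<^sup>T * G * W)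
        (- (P * (X * M)) + L\<^sup>T * Z * l + W\<^sup>T * G * w)
        (- ((X * M)\<^sup>T * P) + l\<^sup>T * Z * L + w\<^sup>T * G * W)
        (- (s\<^sup>T * y) - y * s + l\<^sup>T * Z * l + w\<^sup>T * G * w)"
  proof -
    have "?S\<^sup>T * ?P = four_block_mat (S\<^sup>T * P) ?O ((X * M)\<^sup>T * P) (s\<^sup>T * y)"
    proof -
      have "?S\<^sup>T = four_block_mat (S\<^sup>T) ?O ((X * M)\<^sup>T) (s\<^sup>T)"
        by (simp add: transpose_four_block_mat[OF S XM O(2) s])
      then have "?S\<^sup>T * ?P = four_block_mat (S\<^sup>T * P + ?O * ?O') (S\<^sup>T * ?O + ?O * y)
          ((X * M)\<^sup>T * P + s\<^sup>T * ?O') ((X * M)\<^sup>T * ?O + s\<^sup>T * y)"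
        using S XM s by (simp only:) (intro mult_four_block_mat[OF _ O(1) _ _ P O y], auto)
      moreover have "(X * M)\<^sup>T * P \<in> carrier_mat k r"
        using XM P by (intro mult_carrier_mat) auto
      note right_add_zero_mat[OF this]
      ultimately show ?thesis
        using S P s y X M
        by (simp add: mat_zero_mult_dim)
    qed
    moreover have "?P * ?S = four_block_mat (P * S) (P * (X * M)) ?O' (y * s)"
      using S P M s y X mult_carrier_mat[OF P XM]
      by (simp add: mult_four_block_mat[OF P O y S XM O(2) s] mat_zero_mult_dim)
    moreover have "?L\<^sup>T * Z * ?L = four_block_mat (L\<^sup>T * Z * L) (L\<^sup>T * Z * l) (l\<^sup>T * Z * L) (l\<^sup>T * Z * l)"
      by (rule append_cols_quadratic_form[OF L l Z])
    moreover have "?W\<^sup>T * G * ?W = four_block_mat (W\<^sup>T * G * W) (W\<^sup>T * G * w) (w\<^sup>T * G * W) (w\<^sup>T * G * w)"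
      by (rule append_cols_quadratic_form[OF W w G])
    ultimately show ?thesis
      by (simp add: four_block_mat_uminus four_block_mat_minus four_block_mat_add dims d carrier_matD[OF M])
        (rule cong_four_block_mat, auto simp: mat_zero_simps dims d carrier_matD[OF M])
  qed
  \<comment> \<open>Here \<open>P * (X * M)\<close> collapses to \<open>M\<close>, and
    \<open>M\<close> is the sum of the other two terms.\<close>
  also have "- (P * (X * M)) + L\<^sup>T * Z * l + W\<^sup>T * G * w = 0\<^sub>m r k"
  proof (rule mat_entries_eqI)
    fix i j
    assume "i < dim_row (0\<^sub>m r k)" "j < dim_col (0\<^sub>m r k)"
    then show "(- (P * (X * M)) + L\<^sup>T * Z * l + W\<^sup>T * G * w) $$ (i, j) = 0\<^sub>m r k $$ (i,j)"
      by (simp add: algebra d M_def del: index_mult_mat(1))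
  qed (simp_all add: dims d)
  \<comment> \<open>The transpose of the previous block, by symmetry of \<open>X\<close>,
    \<open>G\<close> and \<open>Z\<close>.\<close>
  also have "- ((X * M)\<^sup>T * P) + l\<^sup>T * Z * L + w\<^sup>T * G * W = 0\<^sub>m k r"
  proof (rule mat_entries_eqI)
    fix i j
    assume "i < dim_row (0\<^sub>m k r)" "j < dim_col (0\<^sub>m k r)"
    then show "(- ((X * M)\<^sup>T * P) + l\<^sup>T * Z * L + w\<^sup>T * G * W) $$ (i, j) = 0\<^sub>m k r $$ (i,j)"
      by (simp add: algebra d M_def del: index_mult_mat(1))
  qed (simp_all add: dims d)
  finally show "- (?S\<^sup>T * ?P) - ?P * ?S + ?L\<^sup>T * Z * ?L + ?W\<^sup>T * G * ?W = 0\<^sub>m (r + k) (r + k)"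
    unfolding lyapunov lyap by simp
qed

end

section \<open>Projection by \<open>W\<close> and \<open>V\<close>\<close>

locale projected_pair = lyapunov_sylvester_pair +
  fixes V :: "real mat"
  assumes V: "V \<in> carrier_mat n r" and WEV: "W\<^sup>T * E * V = 1\<^sub>m r" and CV: "C * V = L * X"
begin

lemma WEV_cancel: "W\<^sup>T * (E * V) = 1\<^sub>m r" "dim_row M = r \<Longrightarrow> W\<^sup>T * (E * (V * M)) = M"
proof -
  show "W\<^sup>T * (E * V) = 1\<^sub>m r"
    using WEV carrier_matD[OF V] by (simp add: algebra)
  show "W\<^sup>T * (E * (V * M)) = M" if "dim_row M = r"
  proof -
    have "W\<^sup>T * (E * (V * M)) = W\<^sup>T * E * V * M"
      using carrier_matD[OF V] that by (simp add: algebra)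
    then show ?thesis using that by (simp add: WEV algebra)
  qed
qed

text \<open>Transpose the Sylvester equation and multiply by \<open>V\<close>: \<open>WEV\<close>
  isolates \<open>S\<^sup>T\<close>, and \<open>CV\<close> replaces \<open>C * V\<close> by
  \<open>L * X\<close>.\<close>

lemma projected_A: "W\<^sup>T * A * V = S\<^sup>T - L\<^sup>T * Z * L * X"
proof (rule mat_entries_eqI)
  fix i j
  assume "i < dim_row (S\<^sup>T - L\<^sup>T * Z * L * X)" "j < dim_col (S\<^sup>T - L\<^sup>T * Z * L * X)"
  moreover have "(A\<^sup>T * W - E\<^sup>T * W * S + C\<^sup>T * Z * L)\<^sup>T * V = 0\<^sub>m r r"
    using V unfolding sylvester by simp
  note mat_eqD[OF this, of i j]
  ultimately show "(W\<^sup>T * A * V) $$ (i, j) = (S\<^sup>T - L\<^sup>T * Z * L * X) $$ (i, j)"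
    by (simp add: algebra carrier_matD[OF V] WEV_cancel CV del: index_mult_mat(1))
qed (simp_all add: dims carrier_matD[OF V])

text \<open>After inserting \<open>projected_A\<close>, the term in \<open>Z\<close> occurs twice
  with a minus sign and once with a plus sign; what remains is
  \<open>inverse_lyapunov\<close>.\<close>

lemma projected_riccati:
  "(W\<^sup>T * A * V)\<^sup>T * X + X * (W\<^sup>T * A * V) - X * W\<^sup>T * G * W * X + (C * V)\<^sup>T * Z * (C * V) = 0\<^sub>m r r"
  unfolding projected_A CV
proof (rule mat_entries_eqI)
  fix i j
  assume "i < dim_row (0\<^sub>m r r)" "j < dim_col (0\<^sub>m r r)"
  then show "((S\<^sup>T - L\<^sup>T * Z * L * X)\<^sup>T * X + X * (S\<^sup>T - L\<^sup>T * Z * L * X) - X * W\<^sup>T * G * W * X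
    + (L * X)\<^sup>T * Z * (L * X)) $$ (i, j) = 0\<^sub>m r r $$ (i, j)"
    using mat_eqD[OF inverse_lyapunov, of i j]
    by (simp add: algebra del: index_mult_mat(1))
qed (simp_all add: dims)

text \<open>By \<open>projected_A\<close> the left side consists of all terms of the Lyapunov
  equation times \<open>X\<close>, up to sign, except \<open>P * S * X\<close>.\<close>

lemma closed_loop: "W\<^sup>T * A * V - W\<^sup>T * G * W * X = P * (- S) * X"
  unfolding projected_A
proof (rule mat_entries_eqI)
  fix i j
  assume "i < dim_row (P * (- S) * X)" "j < dim_col (P * (- S) * X)"
  moreover have "(- (S\<^sup>T * P) - P * S + L\<^sup>T * Z * L + W\<^sup>T * G * W) * X = 0\<^sub>m r r"
    using X unfolding lyapunov by simp
  note mat_eqD[OF this, of i j]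
  ultimately show "(S\<^sup>T - L\<^sup>T * Z * L * X - W\<^sup>T * G * W * X) $$ (i, j) = (P * (- S) * X) $$ (i, j)"
    by (simp add: algebra del: index_mult_mat(1))
qed (simp_all add: dims)

lemma closed_loop_similar: "similar_mat (W\<^sup>T * A * V - W\<^sup>T * G * W * X) (- S)"
  using V X P S W A G by (intro similar_matI[OF _ PX XP closed_loop]) auto

text \<open>Combined with \<open>residual_factorization\<close>, this makes the residual vanish
  between \<open>V\<^sup>T\<close> and \<open>V\<close>.\<close>

lemma defect_V: "(C - L * X * W\<^sup>T * E) * V = 0\<^sub>m q r"
  using L X by (simp add: algebra carrier_matD[OF V] WEV_cancel CV)

text \<open>Passing from \<open>S\<close> to \<open>(W\<^sup>T * A * V)\<^sup>T\<close> changes the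
  second term by \<open>E\<^sup>T * W * X * L\<^sup>T * Z * L\<close>; passing from \<open>C\<close>
  to its defect subtracts the same product.\<close>

lemma projected_sylvester:
  "A\<^sup>T * W - E\<^sup>T * W * (W\<^sup>T * A * V)\<^sup>T + (C - L * X * W\<^sup>T * E)\<^sup>T * Z * L = 0\<^sub>m n r"
  unfolding projected_A
proof (rule mat_entries_eqI)
  fix i j
  assume "i < dim_row (0\<^sub>m n r)" "j < dim_col (0\<^sub>m n r)"
  then show "(A\<^sup>T * W - E\<^sup>T * W * (S\<^sup>T - L\<^sup>T * Z * L * X)\<^sup>T + (C - L * X * W\<^sup>T * E)\<^sup>T * Z * L) $$ (i, j)
    = 0\<^sub>m n r $$ (i, j)"
    using mat_eqD[OF sylvester, of i j] by (simp add: algebra del: index_mult_mat(1))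
qed (simp_all add: dims)

end

section \<open>Shift blocks\<close>

text \<open>\<open>dim_row (s_w q a)\<close> stands for the block size throughout, \<open>q\<close>
  or \<open>2 * q\<close>, so that real shifts and conjugate pairs share one treatment.\<close>

lemma s_w_carrier:
  "s_w q a \<in> carrier_mat (dim_row (s_w q a)) (dim_row (s_w q a))"
  unfolding s_w_def by auto

lemma l_w_carrier: "l_w q a \<in> carrier_mat q (dim_row (s_w q a))"
  unfolding l_w_def s_w_def append_cols_def by auto

lemma split_square_mat:
  assumes "D \<in> carrier_mat (m + m) (m + m)"
  obtains D1 D2 D3 D4 where "D = four_block_mat D1 D2 D3 D4"
    "D1 \<in> carrier_mat m m" "D2 \<in> carrier_mat m m" "D3 \<in> carrier_mat m m" "D4 \<in> carrier_mat m m"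
proof -
  obtain D1 D2 D3 D4 where "split_block D m m = (D1, D2, D3, D4)" by (metis prod_cases4)
  from split_block[OF this] assms that show thesis by auto
qed

section \<open>The Lyapunov operator of a shift block\<close>

text \<open>The homogeneous Lyapunov equation of a conjugate pair at one entry position of the four
  blocks. It forces \<open>c = b\<close> and \<open>d = - a\<close>, and elimination leaves
  \<open>(u * u + v * v) * a = 0\<close>.\<close>

lemma shift_block_linear_system:
  fixes u v a b c d :: real
  assumes u: "u > 0" and eqs: "2 * u * a = v * (b + c)" "2 * u * b = v * (d - a)"
    "2 * u * c = v * (d - a)" "2 * u * d = - v * (b + c)"
  shows "a = 0 \<and> b = 0 \<and> c = 0 \<and> d = 0"
proof -
  have "2 * u * b = 2 * u * c" using eqs(2,3) by (rule trans[OF _ sym])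
  then have c: "c = b" using u by simp
  have "2 * u * (a + d) = 0" using eqs(1,4) by (simp add: algebra_simps)
  then have "a + d = 0" using u by simp
  then have d: "d = - a" by linarith
  have f1: "u * a = v * b" using eqs(1) unfolding c by simp
  have f2: "u * b = - (v * a)" using eqs(2) unfolding d by (simp add: mult.commute)
  have "u * (u * a) = v * (u * b)" unfolding f1 by simp
  also have "\<dots> = - (v * v * a)" unfolding f2 by simp
  finally have "(u * u + v * v) * a = 0" by (simp add: distrib_right)
  then have "a = 0" using u by simp
  moreover have "b = 0" using f2 u \<open>a = 0\<close> by simp
  ultimately show ?thesis using c d by simp
qed

text \<open>For a real shift the operator is multiplication by \<open>- 2 * Re a\<close>, which is
  positive. For a pair all blocks of \<open>s_w\<close> are multiples of the identity, so the
  equation decouples into one 4 by 4 system for each entry position.\<close>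

lemma shift_block_lyapunov_unique:
  assumes a: "Re a < 0" and D: "D \<in> carrier_mat (dim_row (s_w q a)) (dim_row (s_w q a))"
    and eq: "(s_w q a)\<^sup>T * D + D * s_w q a = 0\<^sub>m (dim_row (s_w q a)) (dim_row (s_w q a))"
  shows "D = 0\<^sub>m (dim_row (s_w q a)) (dim_row (s_w q a))"
proof (cases "Im a = 0")
  case True
  then have s: "s_w q a = (- Re a) \<cdot>\<^sub>m 1\<^sub>m q" and k: "dim_row (s_w q a) = q" by (auto simp: s_w_def)
  have D': "D \<in> carrier_mat q q" using D k by simp
  have "(s_w q a)\<^sup>T * D + D * s_w q a = (- 2 * Re a) \<cdot>\<^sub>m D"
    unfolding s using D' by (intro eq_matI) (auto simp: mat_transpose_smult)
  then have *: "(- 2 * Re a) \<cdot>\<^sub>m D = 0\<^sub>m q q" using eq k by simp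
  show ?thesis unfolding k
  proof (rule eq_matI)
    fix i j assume "i < dim_row (0\<^sub>m q q)" "j < dim_col (0\<^sub>m q q)"
    then show "D $$ (i, j) = 0\<^sub>m q q $$ (i, j)"
      using mat_eqD[OF *, of i j] D' a by simp
  qed (use D' in auto)
next
  case False
  define u v where "u = - Re a" and "v = - Im a"
  have s: "s_w q a = four_block_mat (u \<cdot>\<^sub>m 1\<^sub>m q) (v \<cdot>\<^sub>m 1\<^sub>m q) ((-v) \<cdot>\<^sub>m 1\<^sub>m q) (u \<cdot>\<^sub>m 1\<^sub>m q)"
    using False by (simp add: s_w_def u_def v_def)
  have k: "dim_row (s_w q a) = q + q" unfolding s by simp
  obtain D1 D2 D3 D4 where D_eq: "D = four_block_mat D1 D2 D3 D4"
    and c: "D1 \<in> carrier_mat q q" "D2 \<in> carrier_mat q q" "D3 \<in> carrier_mat q q" "D4 \<in> carrier_mat q q"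
    using split_square_mat D unfolding k by metis
  have one: "x \<cdot>\<^sub>m 1\<^sub>m q \<in> carrier_mat q q" for x :: real by simp
  have st: "(s_w q a)\<^sup>T = four_block_mat (u \<cdot>\<^sub>m 1\<^sub>m q) ((-v) \<cdot>\<^sub>m 1\<^sub>m q) (v \<cdot>\<^sub>m 1\<^sub>m q) (u \<cdot>\<^sub>m 1\<^sub>m q)"
    unfolding s by (simp add: transpose_four_block_mat[OF one one one one] mat_transpose_smult)
  have sm: "(x \<cdot>\<^sub>m 1\<^sub>m q) * M = x \<cdot>\<^sub>m M" "M * (x \<cdot>\<^sub>m 1\<^sub>m q) = x \<cdot>\<^sub>m M" if "M \<in> carrier_mat q q"
    for x :: real and M
    using that by (auto simp: mult_smult_distrib[of _ q q _ q] mult_smult_assoc_mat[of _ q q _ q])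
  have "four_block_mat (u \<cdot>\<^sub>m D1 + (-v) \<cdot>\<^sub>m D3 + (u \<cdot>\<^sub>m D1 + (-v) \<cdot>\<^sub>m D2))
     (u \<cdot>\<^sub>m D2 + (-v) \<cdot>\<^sub>m D4 + (v \<cdot>\<^sub>m D1 + u \<cdot>\<^sub>m D2))
     (v \<cdot>\<^sub>m D1 + u \<cdot>\<^sub>m D3 + (u \<cdot>\<^sub>m D3 + (-v) \<cdot>\<^sub>m D4))
     (v \<cdot>\<^sub>m D2 + u \<cdot>\<^sub>m D4 + (v \<cdot>\<^sub>m D3 + u \<cdot>\<^sub>m D4)) = 0\<^sub>m (q + q) (q + q)"
  proof -
    have "(s_w q a)\<^sup>T * D = four_block_mat (u \<cdot>\<^sub>m D1 + (-v) \<cdot>\<^sub>m D3) (u \<cdot>\<^sub>m D2 + (-v) \<cdot>\<^sub>m D4)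
        (v \<cdot>\<^sub>m D1 + u \<cdot>\<^sub>m D3) (v \<cdot>\<^sub>m D2 + u \<cdot>\<^sub>m D4)"
      unfolding st D_eq by (simp only: mult_four_block_mat[OF one one one one c] sm c)
    moreover have "D * s_w q a = four_block_mat (u \<cdot>\<^sub>m D1 + (-v) \<cdot>\<^sub>m D2) (v \<cdot>\<^sub>m D1 + u \<cdot>\<^sub>m D2)
        (u \<cdot>\<^sub>m D3 + (-v) \<cdot>\<^sub>m D4) (v \<cdot>\<^sub>m D3 + u \<cdot>\<^sub>m D4)"
      unfolding s D_eq by (simp only: mult_four_block_mat[OF c one one one one] sm c)
    ultimately show ?thesis
      using eq c unfolding k by (simp add: four_block_mat_add)
  qed
  note eqs = mat_eqD[OF this]
  have uv: "u > 0" using a by (simp add: u_def)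
  have D0: "D1 $$ (i, j) = 0 \<and> D2 $$ (i, j) = 0 \<and> D3 $$ (i, j) = 0 \<and> D4 $$ (i, j) = 0"
    if ij: "i < q" "j < q" for i j
  proof -
    let ?a = "D1 $$ (i, j)" and ?b = "D2 $$ (i, j)" and ?c = "D3 $$ (i, j)" and ?d = "D4 $$ (i, j)"
    \<comment> \<open>An offset of \<open>q\<close> in the row or column index selects the same
      entry of another block.\<close>
    have e1: "2 * u * ?a = v * (?b + ?c)" using eqs[of i j] ij c by (simp add: algebra_simps)
    have e2: "2 * u * ?b = v * (?d - ?a)" using eqs[of i "q + j"] ij c by (simp add: algebra_simps)
    have e3: "2 * u * ?c = v * (?d - ?a)" using eqs[of "q + i" j] ij c by (simp add: algebra_simps)
    have e4: "2 * u * ?d = - v * (?b + ?c)" using eqs[of "q + i" "q + j"] ij c by (simp add: algebra_simps)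
    show ?thesis by (rule shift_block_linear_system[OF uv e1 e2 e3 e4])
  qed
  show ?thesis
    unfolding k D_eq using D0 c by (intro eq_matI) auto
qed

text \<open>Subtracting the transposed equation shows that \<open>Y - Y\<^sup>T\<close> solves the
  homogeneous equation, hence is zero.\<close>

lemma shift_block_lyapunov_symmetric:
  assumes a: "Re a < 0" and Y: "Y \<in> carrier_mat (dim_row (s_w q a)) (dim_row (s_w q a))"
    and Q: "Q \<in> carrier_mat (dim_row (s_w q a)) (dim_row (s_w q a))" "Q\<^sup>T = Q"
    and eq: "- ((s_w q a)\<^sup>T * Y) - Y * s_w q a + Q = 0\<^sub>m (dim_row (s_w q a)) (dim_row (s_w q a))"
  shows "Y\<^sup>T = Y"
proof -
  define s where "s = s_w q a"
  define k where "k = dim_row s"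
  have d: "s \<in> carrier_mat k k" "Y \<in> carrier_mat k k" "Q \<in> carrier_mat k k"
    unfolding s_def k_def by (fact s_w_carrier Y Q(1))+
  note dd = carrier_matD[OF d(1)] carrier_matD[OF d(2)] carrier_matD[OF d(3)]
  have eq': "(- (s\<^sup>T * Y) - Y * s + Q)\<^sup>T = 0\<^sub>m k k" and eq0: "- (s\<^sup>T * Y) - Y * s + Q = 0\<^sub>m k k"
    using eq unfolding s_def k_def by simp_all
  have "s\<^sup>T * (Y - Y\<^sup>T) + (Y - Y\<^sup>T) * s = 0\<^sub>m k k"
  proof (rule mat_entries_eqI)
    fix i j assume "i < dim_row (0\<^sub>m k k)" "j < dim_col (0\<^sub>m k k)"
    then show "(s\<^sup>T * (Y - Y\<^sup>T) + (Y - Y\<^sup>T) * s) $$ (i, j) = 0\<^sub>m k k $$ (i, j)"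
      using mat_eqD[OF eq0, of i j] mat_eqD[OF eq', of i j]
      by (simp add: mat_algebra dd Q(2) del: index_mult_mat(1))
  qed (simp_all add: dd)
  moreover have "Y - Y\<^sup>T \<in> carrier_mat k k" by (rule minus_carrier_mat) (simp add: d(2))
  ultimately have D: "Y - Y\<^sup>T = 0\<^sub>m k k"
    unfolding s_def k_def by (rule shift_block_lyapunov_unique[OF a, rotated])
  show ?thesis
  proof (rule mat_entries_eqI)
    fix i j assume "i < dim_row Y" "j < dim_col Y"
    then show "Y\<^sup>T $$ (i, j) = Y $$ (i, j)"
      using mat_eqD[OF D, of i j] dd by simp
  qed (simp_all add: dd)
qed

section \<open>Characteristic polynomials and spectra\<close>

lemma char_poly_block_upper_triangular:
  fixes A :: "'a :: idom mat"
  assumes A: "A \<in> carrier_mat n n" and B: "B \<in> carrier_mat n m" and D: "D \<in> carrier_mat m m"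
  shows "char_poly (four_block_mat A B (0\<^sub>m m n) D) = char_poly A * char_poly D"
proof -
  have "char_poly_matrix (four_block_mat A B (0\<^sub>m m n) D)
    = four_block_mat (char_poly_matrix A) (map_mat (\<lambda>a. [:- a:]) B) (0\<^sub>m m n) (char_poly_matrix D)"
    unfolding char_poly_matrix_def using A B D by (intro eq_matI) (auto simp: one_poly_def)
  then show ?thesis
    unfolding char_poly_def using A B D
    by (simp add: det_four_block_mat_lower_left_zero[OF _ _ refl, of _ n _ m])
qed

lemma smult_one_mult: "(c \<cdot>\<^sub>m 1\<^sub>m q) * (d \<cdot>\<^sub>m 1\<^sub>m q) = (c * d :: 'a :: comm_ring_1) \<cdot>\<^sub>m 1\<^sub>m q"
  by (simp add: mult_smult_distrib[of _ q q _ q], intro eq_matI) (auto simp: mult.commute)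

lemma smult_one_minus: "c \<cdot>\<^sub>m 1\<^sub>m q - d \<cdot>\<^sub>m 1\<^sub>m q = (c - d :: 'a :: comm_ring_1) \<cdot>\<^sub>m 1\<^sub>m q"
  by (intro eq_matI) auto

text \<open>The sign is that of \<open>closed_loop_similar\<close>, which compares the closed loop
  with \<open>- S\<close>.\<close>

lemma char_poly_shift_block:
  "char_poly (map_mat complex_of_real (- s_w q a)) = (\<Prod>z\<in>#block_shifts a. [:- z, 1:] ^ q)"
proof (cases "Im a = 0")
  case True
  then have a: "a = complex_of_real (Re a)" by (simp add: complex_eq_iff)
  have "char_poly_matrix (map_mat complex_of_real (- s_w q a)) = [:- a, 1:] \<cdot>\<^sub>m 1\<^sub>m q"
    unfolding char_poly_matrix_def s_w_def using True a
    by (intro eq_matI) (auto simp: complex_eq_iff)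
  then show ?thesis
    using True by (simp add: char_poly_def block_shifts_def det_smult)
next
  case False
  let ?I = "1\<^sub>m q :: complex poly mat"
  have "char_poly_matrix (map_mat complex_of_real (- s_w q a))
    = four_block_mat ([:- of_real (Re a), 1:] \<cdot>\<^sub>m ?I) ([:- of_real (Im a):] \<cdot>\<^sub>m ?I)
        ([:of_real (Im a):] \<cdot>\<^sub>m ?I) ([:- of_real (Re a), 1:] \<cdot>\<^sub>m ?I)"
    unfolding char_poly_matrix_def s_w_def using False
    by (intro eq_matI) (auto simp: complex_eq_iff)
  \<comment> \<open>The four blocks are scalar matrices and commute, so the determinant is that of
    the 2 by 2 determinant of the blocks. This is again a scalar matrix, with factor (x - Re a)^2 +
    (Im a)^2.\<close>
  moreover have "det (four_block_mat ([:- of_real (Re a), 1:] \<cdot>\<^sub>m ?I) ([:- of_real (Im a):] \<cdot>\<^sub>m ?I)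
        ([:of_real (Im a):] \<cdot>\<^sub>m ?I) ([:- of_real (Re a), 1:] \<cdot>\<^sub>m ?I))
      = det (([:- of_real (Re a), 1:] * [:- of_real (Re a), 1:]
            - [:- of_real (Im a):] * [:of_real (Im a):]) \<cdot>\<^sub>m ?I)"
    unfolding smult_one_mult[symmetric] smult_one_minus[symmetric]
    by (rule det_four_block_mat[of _ q]) (simp_all only: smult_one_mult mult.commute smult_carrier_mat one_carrier_mat)
  moreover have "[:- of_real (Re a), 1:] * [:- of_real (Re a), 1:] - [:- of_real (Im a):] * [:of_real (Im a):]
     = [:- a, 1:] * [:- cnj a, 1:]"
    by (simp add: complex_eq_iff)
  ultimately have "char_poly (map_mat complex_of_real (- s_w q a)) = ([:- a, 1:] * [:- cnj a, 1:]) ^ q"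
    by (simp only: char_poly_def det_smult det_one one_carrier_mat index_one_mat mult_1_right)
  also have "\<dots> = [:- a, 1:] ^ q * [:- cnj a, 1:] ^ q" by (rule power_mult_distrib)
  finally show ?thesis using False by (simp add: block_shifts_def)
qed

text \<open>\<open>order\<close> is additive on nonzero products, and a factor contributes
  \<open>q\<close> exactly when its root is \<open>z\<close>.\<close>

lemma order_prod_linear_powers:
  fixes z :: "'a :: field"
  shows "order z (\<Prod>w\<in>#M. [:- w, 1:] ^ q) = q * count M z"
proof (induction M)
  case empty
  then show ?case by (simp add: order_0I)
next
  case (add w M)
  have nz: "[:- w, 1:] ^ q * (\<Prod>w\<in>#M. [:- w, 1:] ^ q) \<noteq> 0"
    by (auto simp: prod_mset_zero_iff)
  have "order z ([:- w, 1:] ^ q) = (if z = w then q else 0)"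
    by (auto simp: order_power_n_n intro!: order_0I)
  then show ?case using add order_mult[OF nz] by simp
qed

lemma spectrum_char_poly_prod:
  assumes M: "M \<in> carrier_mat r r" and q: "0 < q"
    and cp: "char_poly (map_mat complex_of_real M) = (\<Prod>z\<in>#F. [:- z, 1:] ^ q)"
  shows "alg_mult M z = q * count F z" "complex_spectrum M = set_mset F"
proof -
  show m: "alg_mult M z = q * count F z" for z
    unfolding alg_mult_def cp by (rule order_prod_linear_powers)
  have M': "map_mat complex_of_real M \<in> carrier_mat r r" using M by simp
  \<comment> \<open>\<open>order_root\<close> identifies roots with points of positive order only
    for a nonzero polynomial; monicity provides this. With \<open>0 < q\<close>, positive order then
    means membership in \<open>F\<close>.\<close>
  then have "char_poly (map_mat complex_of_real M) \<noteq> 0"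
    using degree_monic_char_poly[OF M'] by auto
  then have "z \<in> complex_spectrum M \<longleftrightarrow> alg_mult M z \<noteq> 0" for z
    unfolding complex_spectrum_def alg_mult_def spectrum_def mem_Collect_eq
      eigenvalue_root_char_poly[OF M'] by (simp add: order_root)
  then show "complex_spectrum M = set_mset F" using m q by (auto simp: set_eq_iff)
qed

lemma in_sum_mset_elem:
  "finite A \<Longrightarrow> z \<in># (\<Sum>j\<in>A. f j) \<Longrightarrow> \<exists>j\<in>A. z \<in># f j"
  by (induction rule: finite_induct) auto

text \<open>Conjugation preserves the real part, so both members of a pair inherit the sign of the
  representative.\<close>

lemma block_shifts_sum_Re:
  fixes \<alpha> :: "nat \<Rightarrow> complex"
  assumes "z \<in># (\<Sum>j=1..i. block_shifts (\<alpha> j))" "\<forall>j\<in>{1..i}. Re (\<alpha> j) < 0"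
  shows "Re z < 0"
  using in_sum_mset_elem[OF finite_atLeastAtMost assms(1)] assms(2)
  by (auto simp: block_shifts_def split: if_splits)

section \<open>The recursion\<close>

context riccati_data
begin

text \<open>Base case of the recursion: with \<open>r = 0\<close> both equations hold between
  matrices without columns, so the first step is an ordinary \<open>extend\<close>.\<close>

lemma empty_pair:
  "lyapunov_sylvester_pair n q E A G C Z 0 (0\<^sub>m n 0) (0\<^sub>m 0 0) (0\<^sub>m 0 0) (0\<^sub>m q 0) (0\<^sub>m 0 0)"
proof unfold_locales
  show "A\<^sup>T * 0\<^sub>m n 0 - E\<^sup>T * 0\<^sub>m n 0 * 0\<^sub>m 0 0 + C\<^sup>T * Z * 0\<^sub>m q 0 = 0\<^sub>m n 0"
    by (rule mat_entries_eqI) (use A C Z E in auto)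
qed (auto intro!: mat_entries_eqI)

text \<open>Induction on \<open>j\<close> from the empty pair. The characteristic polynomial, the
  columns of \<open>L j * X j\<close> and the increment of \<open>W j * X j * (W j)\<^sup>T\<close>
  are carried along because they rest on the same bordered forms. The last conjunct is guarded since
  \<open>j - 1\<close> is truncated at \<open>0\<close>.\<close>

lemma recursion_pair:
  fixes \<alpha> :: "nat \<Rightarrow> complex" and w x W X S L Cperp :: "nat \<Rightarrow> real mat"
  assumes shifts: "\<forall>j\<in>{1..N}. Re (\<alpha> j) < 0"
    and init: "W 0 = 0\<^sub>m n 0" "X 0 = 0\<^sub>m 0 0" "S 0 = 0\<^sub>m 0 0" "L 0 = 0\<^sub>m q 0" "Cperp 0 = C"
    and w_carrier: "\<forall>j\<in>{1..N}. w j \<in> carrier_mat n (dim_row (s_w q (\<alpha> j)))"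
    and w_eq: "\<forall>j\<in>{1..N}. (A - G * W (j-1) * X (j-1) * (W (j-1))\<^sup>T * E)\<^sup>T * w j
        - E\<^sup>T * w j * s_w q (\<alpha> j) + (Cperp (j-1))\<^sup>T * Z * l_w q (\<alpha> j)
      = 0\<^sub>m n (dim_row (s_w q (\<alpha> j)))"
    and x_eq: "\<forall>j\<in>{1..N}. \<exists>Y \<in> carrier_mat (dim_row (s_w q (\<alpha> j))) (dim_row (s_w q (\<alpha> j))).
        - ((s_w q (\<alpha> j))\<^sup>T * Y) - Y * s_w q (\<alpha> j) + (l_w q (\<alpha> j))\<^sup>T * Z * l_w q (\<alpha> j)
          + (w j)\<^sup>T * G * w j = 0\<^sub>m (dim_row (s_w q (\<alpha> j))) (dim_row (s_w q (\<alpha> j)))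
        \<and> invertible_mat Y \<and> x j = minv Y"
    and S: "\<forall>j\<in>{1..N}. S j = four_block_mat (S (j-1))
        (X (j-1) * ((L (j-1))\<^sup>T * Z * l_w q (\<alpha> j) + (W (j-1))\<^sup>T * G * w j))
        (0\<^sub>m (dim_row (s_w q (\<alpha> j))) (dim_col (S (j-1)))) (s_w q (\<alpha> j))"
    and L: "\<forall>j\<in>{1..N}. L j = append_cols (L (j-1)) (l_w q (\<alpha> j))"
    and W: "\<forall>j\<in>{1..N}. W j = append_cols (W (j-1)) (w j)"
    and X: "\<forall>j\<in>{1..N}. X j = diag_block_mat [X (j-1), x j]"
    and Cperp: "\<forall>j\<in>{1..N}. Cperp j = C - L j * X j * (W j)\<^sup>T * E"
    and j: "j \<le> N"
  shows "(\<exists>P. lyapunov_sylvester_pair n q E A G C Z (dim_col (W j)) (W j) (X j) (S j) (L j) P)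
    \<and> char_poly (map_mat complex_of_real (- S j)) = (\<Prod>z\<in>#(\<Sum>k=1..j. block_shifts (\<alpha> k)). [:- z, 1:] ^ q)
    \<and> L j * X j = concat_cols q (map (\<lambda>k. l_w q (\<alpha> k) * x k) [1..<Suc j])
    \<and> (0 < j \<longrightarrow> x j \<in> carrier_mat (dim_row (s_w q (\<alpha> j))) (dim_row (s_w q (\<alpha> j)))
        \<and> W j * X j * (W j)\<^sup>T = W (j-1) * X (j-1) * (W (j-1))\<^sup>T + w j * x j * (w j)\<^sup>T)"
  using j
proof (induction j)
  case 0
  have "char_poly (map_mat complex_of_real (- (0\<^sub>m 0 0))) = 1"
    by (simp add: char_poly_def)
  then show ?case
    using empty_pair by (auto simp: init concat_cols_def)
next
  case (Suc j)
  define r k s l where "r = dim_col (W j)" and "k = dim_row (s_w q (\<alpha> (Suc j)))"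
    and "s = s_w q (\<alpha> (Suc j))" and "l = l_w q (\<alpha> (Suc j))"
  have J: "Suc j \<in> {1..N}" using Suc.prems by simp
  obtain P where pair: "lyapunov_sylvester_pair n q E A G C Z r (W j) (X j) (S j) (L j) P"
    and cp: "char_poly (map_mat complex_of_real (- S j)) = (\<Prod>z\<in>#(\<Sum>k=1..j. block_shifts (\<alpha> k)). [:- z, 1:] ^ q)"
    and LX: "L j * X j = concat_cols q (map (\<lambda>k. l_w q (\<alpha> k) * x k) [1..<Suc j])"
    using Suc unfolding r_def by auto
  interpret pair: lyapunov_sylvester_pair n q E A G C Z r "W j" "X j" "S j" "L j" P by (rule pair)
  \<comment> \<open>\<open>Cperp\<close> is given by this formula only from index 1 on; at 0 the
    subtracted product of empty matrices is zero.\<close>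
  have Cj: "Cperp j = C - L j * X j * (W j)\<^sup>T * E"
  proof (cases j)
    case 0
    have "C - 0\<^sub>m q 0 * 0\<^sub>m 0 0 * (0\<^sub>m n 0)\<^sup>T * E = C"
      using C E by (simp add: mat_zero_mult_dim mat_zero_simps)
    then show ?thesis by (simp add: 0 init)
  next
    case (Suc i)
    then show ?thesis using Cperp J by auto
  qed
  note facts = bspec[OF w_carrier J] bspec[OF w_eq J] bspec[OF x_eq J] bspec[OF S J] bspec[OF L J]
    bspec[OF W J] bspec[OF X J] bspec[OF shifts J]
  note facts' = facts[unfolded diff_Suc_1 Cj, folded s_def l_def, folded k_def[folded s_def]]
  have w: "w (Suc j) \<in> carrier_mat n k" by (rule facts'(1))
  have s: "s \<in> carrier_mat k k" and l: "l \<in> carrier_mat q k"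
    unfolding s_def l_def k_def by (rule s_w_carrier l_w_carrier)+
  obtain Y where Y: "Y \<in> carrier_mat k k" "invertible_mat Y" "x (Suc j) = minv Y"
    and lyap: "- (s\<^sup>T * Y) - Y * s + l\<^sup>T * Z * l + (w (Suc j))\<^sup>T * G * w (Suc j) = 0\<^sub>m k k"
    using facts'(3) by auto
  \<comment> \<open>The constant term of the Lyapunov equation is symmetric, which makes its
    solution \<open>Y\<close> and then the inverse \<open>x (Suc j)\<close> symmetric.\<close>
  have Q: "l\<^sup>T * Z * l + (w (Suc j))\<^sup>T * G * w (Suc j) \<in> carrier_mat k k"
    "(l\<^sup>T * Z * l + (w (Suc j))\<^sup>T * G * w (Suc j))\<^sup>T = l\<^sup>T * Z * l + (w (Suc j))\<^sup>T * G * w (Suc j)"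
    using Z G l w by (auto simp: mat_algebra Z_sym G_sym)
  have "- (s\<^sup>T * Y) - Y * s + (l\<^sup>T * Z * l + (w (Suc j))\<^sup>T * G * w (Suc j)) = 0\<^sub>m k k"
    unfolding lyap[symmetric] using s Y(1) l w Z G by (intro assoc_add_mat[symmetric, of _ k k]) auto
  then have Y_sym: "Y\<^sup>T = Y"
    using shift_block_lyapunov_symmetric[where q = q, OF facts(8), folded s_def, folded k_def[folded s_def], OF Y(1) Q] by simp
  note I = minv_inverse[OF Y(1,2), folded Y(3)]
  have x_sym: "(x (Suc j))\<^sup>T = x (Suc j)"
    unfolding Y(3) by (rule minv_transpose[OF Y(1,2) Y_sym])
  have dim_S: "dim_col (S j) = r" using pair.S by simp
  have X': "X (Suc j) = four_block_mat (X j) (0\<^sub>m r k) (0\<^sub>m k r) (x (Suc j))"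
    unfolding facts'(7) diag_block_mat_pair using I(1) pair.X by simp
  have r': "dim_col (W (Suc j)) = r + k"
    unfolding facts'(6) append_cols_def using w pair.W by simp
  have "lyapunov_sylvester_pair n q E A G C Z (dim_col (W (Suc j))) (W (Suc j)) (X (Suc j)) (S (Suc j)) (L (Suc j))
      (four_block_mat P (0\<^sub>m r k) (0\<^sub>m k r) Y)"
    \<comment> \<open>Two rounds: the size \<open>dim_col (W (Suc j))\<close> must be replaced
      before \<open>W (Suc j)\<close> itself is expanded.\<close>
    unfolding r' unfolding X' facts'(4,5,6) dim_S
    by (rule pair.extend[OF w I(1) s l Y(1) x_sym I(3,2) facts'(2) lyap])
  moreover have "char_poly (map_mat complex_of_real (- S (Suc j)))
      = (\<Prod>z\<in>#(\<Sum>k=1..Suc j. block_shifts (\<alpha> k)). [:- z, 1:] ^ q)"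
  proof -
    define M where "M = X j * ((L j)\<^sup>T * Z * l + (W j)\<^sup>T * G * w (Suc j))"
    have M: "M \<in> carrier_mat r k"
      unfolding M_def using pair.X pair.L pair.W Z G l w by auto
    have "map_mat complex_of_real (- S (Suc j)) = four_block_mat (map_mat complex_of_real (- S j))
        (map_mat complex_of_real (- M)) (0\<^sub>m k r) (map_mat complex_of_real (- s))"
      unfolding facts'(4) dim_S M_def[symmetric] using pair.S M s by (intro eq_matI) auto
    moreover have "char_poly \<dots> = char_poly (map_mat complex_of_real (- S j)) * char_poly (map_mat complex_of_real (- s))"
      using pair.S M s by (intro char_poly_block_upper_triangular) auto
    ultimately show ?thesis
      by (simp add: cp s_def char_poly_shift_block)
  qed
  moreover have "L (Suc j) * X (Suc j) = concat_cols q (map (\<lambda>k. l_w q (\<alpha> k) * x k) [1..<Suc (Suc j)])"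
  proof -
    have "L (Suc j) * X (Suc j) = append_cols (L j * X j) (l * x (Suc j))"
      unfolding X' facts'(5) by (rule append_cols_mult_block_diag[OF pair.L l pair.X I(1)])
    \<comment> \<open>\<open>concat_cols\<close> folds from the left, so one more index appends one
      block on the right.\<close>
    then show ?thesis unfolding LX by (simp add: concat_cols_def l_def)
  qed
  moreover have "W (Suc j) * X (Suc j) * (W (Suc j))\<^sup>T = W j * X j * (W j)\<^sup>T + w (Suc j) * x (Suc j) * (w (Suc j))\<^sup>T"
    unfolding X' facts'(6) by (rule block_diag_sandwich[OF pair.W w pair.X I(1)])
  ultimately show ?case
    using I(1) unfolding k_def by auto
qed

end

text \<open>The gain is affine in its last argument; the constant \<open>C\<close> enters only
  once.\<close>

lemma gain_add:
  assumes "E \<in> carrier_mat n n" "B \<in> carrier_mat n m" "C \<in> carrier_mat m n" "minv R \<in> carrier_mat m m"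
    and "Y \<in> carrier_mat n n" "D \<in> carrier_mat n n"
  shows "gain E B C R (Y + D) = gain E B C R Y + minv R * (B\<^sup>T * D * E)"
proof -
  note d = assms[THEN carrier_matD(1)] assms[THEN carrier_matD(2)]
  show ?thesis
    unfolding gain_def
    by (rule mat_entries_eqI) (simp_all add: mat_algebra d del: index_mult_mat(1))
qed

section \<open>The four claims for the original data\<close>

theorem theorem2p2:
  fixes n m1 m2 p q r N i :: nat
    and E A B1 B2 C1 C2 R1 R2 Z :: "real mat"
    and Ahat Btil Bhat Rhat Chat Zhat :: "real mat"
    and \<alpha> :: "nat \<Rightarrow> complex"
    and w x W X S L Cperp :: "nat \<Rightarrow> real mat"
    and V Ahat_r A_r Bhat_r B1_r B2_r Chat_r C1_r C2_r Acl :: "real mat"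
    and Xhat K :: "nat \<Rightarrow> real mat"
    and R_s :: "real mat"
  assumes E: "E \<in> carrier_mat n n" and A: "A \<in> carrier_mat n n"
    and B1: "B1 \<in> carrier_mat n m1" and B2: "B2 \<in> carrier_mat n m2"
    and C1: "C1 \<in> carrier_mat p n" and C2: "C2 \<in> carrier_mat m1 n"
    and R1: "R1 \<in> carrier_mat m1 m1" "R1\<^sup>T = R1" "invertible_mat R1"
    and R2: "R2 \<in> carrier_mat m2 m2" "R2\<^sup>T = R2" "invertible_mat R2"
    and Z: "Z \<in> carrier_mat p p" "Z\<^sup>T = Z"
    and q: "q = p + m1" "0 < q"
    and Btil: "Btil = append_cols (0\<^sub>m n p) B1"
    and Bhat: "Bhat = append_cols B1 B2"
    and Rhat: "Rhat = diag_block_mat [R1, - R2]"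
    and Chat: "Chat = C1 @\<^sub>r C2"
    and Zhat: "Zhat = diag_block_mat [Z, - minv R1]"
    and Ahat: "Ahat = A + Btil * Zhat * Chat"
    and shifts: "\<forall>j\<in>{1..N}. Re (\<alpha> j) < 0"
    and init: "W 0 = 0\<^sub>m n 0" "X 0 = 0\<^sub>m 0 0" "S 0 = 0\<^sub>m 0 0" "L 0 = 0\<^sub>m q 0" "Cperp 0 = Chat"
    and w_carrier: "\<forall>j\<in>{1..N}. w j \<in> carrier_mat n (dim_row (s_w q (\<alpha> j)))"
    and w_eq: "\<forall>j\<in>{1..N}.
          (Ahat - Bhat * minv Rhat * Bhat\<^sup>T * W (j-1) * X (j-1) * (W (j-1))\<^sup>T * E)\<^sup>T * w j
            - E\<^sup>T * w j * s_w q (\<alpha> j) + (Cperp (j-1))\<^sup>T * Zhat * l_w q (\<alpha> j)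
          = 0\<^sub>m n (dim_row (s_w q (\<alpha> j)))"
    and x_eq: "\<forall>j\<in>{1..N}. \<exists>Y \<in> carrier_mat (dim_row (s_w q (\<alpha> j))) (dim_row (s_w q (\<alpha> j))).
          - ((s_w q (\<alpha> j))\<^sup>T * Y) - Y * s_w q (\<alpha> j)
            + (l_w q (\<alpha> j))\<^sup>T * Zhat * l_w q (\<alpha> j)
            + (w j)\<^sup>T * Bhat * minv Rhat * Bhat\<^sup>T * w j
          = 0\<^sub>m (dim_row (s_w q (\<alpha> j))) (dim_row (s_w q (\<alpha> j)))
          \<and> invertible_mat Y \<and> x j = minv Y"
    and S: "\<forall>j\<in>{1..N}. S j = four_block_mat
          (S (j-1))
          (X (j-1) * ((L (j-1))\<^sup>T * Zhat * l_w q (\<alpha> j)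
                      + (W (j-1))\<^sup>T * Bhat * minv Rhat * Bhat\<^sup>T * w j))
          (0\<^sub>m (dim_row (s_w q (\<alpha> j))) (dim_col (S (j-1))))
          (s_w q (\<alpha> j))"
    and L: "\<forall>j\<in>{1..N}. L j = append_cols (L (j-1)) (l_w q (\<alpha> j))"
    and W: "\<forall>j\<in>{1..N}. W j = append_cols (W (j-1)) (w j)"
    and X: "\<forall>j\<in>{1..N}. X j = diag_block_mat [X (j-1), x j]"
    and Cperp: "\<forall>j\<in>{1..N}. Cperp j = Chat - L j * X j * (W j)\<^sup>T * E"
    and i: "i \<in> {1..N}"
    and r: "r = dim_col (W i)"
    and V: "V \<in> carrier_mat n r" "(W i)\<^sup>T * E * V = 1\<^sub>m r"
    and Ahat_r: "Ahat_r = (W i)\<^sup>T * Ahat * V"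
    and A_r: "A_r = (W i)\<^sup>T * A * V"
    and Bhat_r: "Bhat_r = (W i)\<^sup>T * Bhat"
    and B1_r: "B1_r = (W i)\<^sup>T * B1" and B2_r: "B2_r = (W i)\<^sup>T * B2"
    and Chat_r: "Chat_r = Chat * V"
    and C1_r: "C1_r = C1 * V" and C2_r: "C2_r = C2 * V"
    and match: "Chat_r = L i * X i"
    and Acl: "Acl = Ahat_r - Bhat_r * minv Rhat * Bhat_r\<^sup>T * X i"
    and Xhat: "\<forall>j\<in>{0..N}. Xhat j = W j * X j * (W j)\<^sup>T"
    and R_s: "R_s = Ahat\<^sup>T * Xhat i * E + E\<^sup>T * Xhat i * Ahat
          - E\<^sup>T * Xhat i * Bhat * minv Rhat * Bhat\<^sup>T * Xhat i * E + Chat\<^sup>T * Zhat * Chat"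
    and K: "\<forall>j\<in>{0..N}. K j = gain E B1 C2 R1 (Xhat j)"
  shows
    \<comment> \<open>the facts the setting records along the way\<close>
    "(Ahat\<^sup>T * W i - E\<^sup>T * W i * S i + Chat\<^sup>T * Zhat * L i = 0\<^sub>m n r
      \<and> invertible_mat (X i)
      \<and> - ((S i)\<^sup>T * minv (X i)) - minv (X i) * S i + (L i)\<^sup>T * Zhat * L i
          + (W i)\<^sup>T * Bhat * minv Rhat * Bhat\<^sup>T * W i = 0\<^sub>m r r
      \<and> Bhat_r = append_cols B1_r B2_r
      \<and> Chat_r = C1_r @\<^sub>r C2_r
      \<and> Ahat_r = (S i)\<^sup>T - (L i)\<^sup>T * Zhat * Chat_r
      \<and> L i * X i = concat_cols q (map (\<lambda>j. l_w q (\<alpha> j) * x j) [1..<Suc i]))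
    \<and> \<comment> \<open>1\<close>
     (Ahat_r\<^sup>T * X i + X i * Ahat_r - X i * Bhat_r * minv Rhat * Bhat_r\<^sup>T * X i
          + Chat_r\<^sup>T * Zhat * Chat_r = 0\<^sub>m r r
      \<and> hurwitz Acl
      \<and> Acl = A_r + B2_r * minv R2 * B2_r\<^sup>T * X i
               - B1_r * minv R1 * (B1_r\<^sup>T * X i + C2_r)
      \<and> complex_spectrum Acl = set_mset (\<Sum>j=1..i. block_shifts (\<alpha> j))
      \<and> (\<forall>z. alg_mult Acl z = (p + m1) * count (\<Sum>j=1..i. block_shifts (\<alpha> j)) z))
    \<and> \<comment> \<open>2\<close>
     (V\<^sup>T * R_s * V = 0\<^sub>m r r \<and> R_s = (Cperp i)\<^sup>T * Zhat * Cperp i)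
    \<and> \<comment> \<open>3\<close>
     (K i = K (i-1) + minv R1 * (B1\<^sup>T * w i * x i * (w i)\<^sup>T * E)
      \<and> K 0 = minv R1 * C2)
    \<and> \<comment> \<open>4\<close>
     (Ahat\<^sup>T * W i - E\<^sup>T * W i * Ahat_r\<^sup>T + (Cperp i)\<^sup>T * Zhat * L i = 0\<^sub>m n r)"
proof -
  let ?R1i = "minv R1" and ?R2i = "minv R2"
  note I1 = minv_inverse[OF R1(1,3)] and I2 = minv_inverse[OF R2(1,3)]
  have sym_inv: "?R1i\<^sup>T = ?R1i" "?R2i\<^sup>T = ?R2i"
    using minv_transpose[OF R1(1,3,2)] minv_transpose[OF R2(1,3,2)] by auto
  define G where "G = Bhat * minv Rhat * Bhat\<^sup>T"
  note d = carrier_matD[OF E] carrier_matD[OF A] carrier_matD[OF B1] carrier_matD[OF B2]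
    carrier_matD[OF C1] carrier_matD[OF C2] carrier_matD[OF Z(1)] carrier_matD[OF I1(1)] carrier_matD[OF I2(1)]
  have mI2: "- ?R2i \<in> carrier_mat m2 m2" using I2(1) by simp
  have Rhat_inv: "minv Rhat = four_block_mat ?R1i (0\<^sub>m m1 m2) (0\<^sub>m m2 m1) (- ?R2i)"
    unfolding Rhat by (rule minv_block_diag[OF R1(1,3) R2(1,3)])
  have Bhat_c: "Bhat \<in> carrier_mat n (m1 + m2)" unfolding Bhat using B1 B2 by simp
  have Rhat_c: "minv Rhat \<in> carrier_mat (m1 + m2) (m1 + m2)" unfolding Rhat_inv using I1(1) mI2 by simp
  \<comment> \<open>The split form yields the symmetry of \<open>G\<close> and, later, the
    expression of the closed loop through \<open>R1\<close> and \<open>R2\<close>.\<close>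
  have G_eq: "G = B1 * ?R1i * B1\<^sup>T - B2 * ?R2i * B2\<^sup>T"
  proof -
    have "G = B1 * ?R1i * B1\<^sup>T + B2 * (- ?R2i) * B2\<^sup>T"
      unfolding G_def Rhat_inv Bhat by (rule block_diag_sandwich[OF B1 B2 I1(1) mI2])
    also have "\<dots> = B1 * ?R1i * B1\<^sup>T - B2 * ?R2i * B2\<^sup>T"
      by (rule mat_entries_eqI) (simp_all add: mat_algebra d del: index_mult_mat(1))
    finally show ?thesis .
  qed
  have G_c: "G \<in> carrier_mat n n" unfolding G_eq using B1 B2 I1(1) I2(1) by auto
  have G_sym: "G\<^sup>T = G" unfolding G_eq by (simp add: mat_algebra d sym_inv)
  have mR1i: "- ?R1i \<in> carrier_mat m1 m1" using I1(1) by simp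
  have Zhat_eq: "Zhat = four_block_mat Z (0\<^sub>m p m1) (0\<^sub>m m1 p) (- ?R1i)"
    unfolding Zhat diag_block_mat_pair using Z(1) I1(1) by simp
  have Zhat_c: "Zhat \<in> carrier_mat q q" unfolding Zhat_eq q using Z(1) I1(1) by simp
  have Zhat_sym: "Zhat\<^sup>T = Zhat"
    unfolding Zhat_eq using Z I1(1) sym_inv
    by (simp add: transpose_four_block_mat[of _ p p _ m1 _ m1] mat_transpose_uminus)
  have Chat_c: "Chat \<in> carrier_mat q n" unfolding Chat q by (rule carrier_append_rows[OF C1 C2])
  \<comment> \<open>The zero block of \<open>Btil\<close> removes \<open>Z\<close> and
    \<open>C1\<close>, leaving only the part with \<open>- minv R1\<close>.\<close>
  have Ahat_eq: "Ahat = A - B1 * ?R1i * C2"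
  proof -
    have "Btil * Zhat = append_cols (0\<^sub>m n p * Z) (B1 * (- ?R1i))"
      unfolding Btil Zhat_eq by (rule append_cols_mult_block_diag[OF _ B1 Z(1) mR1i]) simp
    then have "Btil * Zhat * Chat = 0\<^sub>m n p * Z * C1 + B1 * (- ?R1i) * C2"
      unfolding Chat using B1 mR1i Z(1) C1 C2 by (simp only:) (intro append_cols_mult_append_rows, auto)
    also have "\<dots> = - (B1 * ?R1i * C2)"
      by (rule mat_entries_eqI) (simp_all add: mat_algebra d del: index_mult_mat(1))
    finally show ?thesis unfolding Ahat
      by (simp only:) (rule mat_entries_eqI, simp_all add: d del: index_mult_mat(1))
  qed
  have Ahat_c: "Ahat \<in> carrier_mat n n" unfolding Ahat_eq using A B1 I1(1) C2 by auto
  interpret riccati_data n q E Ahat G Chat Zhat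
    by unfold_locales (fact E Ahat_c G_c Chat_c Zhat_c G_sym Zhat_sym)+
  \<comment> \<open>Under left association \<open>G\<close> is not a subterm of these products, so
    folding \<open>G_def\<close> is not enough. The row counts collected next discharge the side
    condition.\<close>
  have G_assoc: "U\<^sup>T * Bhat * minv Rhat * Bhat\<^sup>T = U\<^sup>T * G" if "dim_row U = n" for U :: "real mat"
    unfolding G_def using that carrier_matD[OF Bhat_c] carrier_matD[OF Rhat_c] by (simp add: mat_mult_assoc_dim)

  have w_row: "dim_row (w j) = n" if "j \<in> {1..N}" for j using w_carrier that by auto
  have W_row: "dim_row (W j) = n" if "j \<le> N" for j
    using that
  proof (induction j)
    case (Suc j)
    then show ?case using bspec[OF W, of "Suc j"] by (simp add: append_cols_def)
  qed (simp add: init)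
  have W_row': "dim_row (W (j - 1)) = n" if "j \<in> {1..N}" for j using W_row[of "j - 1"] that by auto
  have x_eq': "\<forall>j\<in>{1..N}. \<exists>Y \<in> carrier_mat (dim_row (s_w q (\<alpha> j))) (dim_row (s_w q (\<alpha> j))).
          - ((s_w q (\<alpha> j))\<^sup>T * Y) - Y * s_w q (\<alpha> j) + (l_w q (\<alpha> j))\<^sup>T * Zhat * l_w q (\<alpha> j)
            + (w j)\<^sup>T * G * w j = 0\<^sub>m (dim_row (s_w q (\<alpha> j))) (dim_row (s_w q (\<alpha> j)))
          \<and> invertible_mat Y \<and> x j = minv Y"
    using x_eq by (simp only: G_assoc w_row simp_thms cong: ball_cong) blast
  have S': "\<forall>j\<in>{1..N}. S j = four_block_mat (S (j-1))
        (X (j-1) * ((L (j-1))\<^sup>T * Zhat * l_w q (\<alpha> j) + (W (j-1))\<^sup>T * G * w j))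
        (0\<^sub>m (dim_row (s_w q (\<alpha> j))) (dim_col (S (j-1)))) (s_w q (\<alpha> j))"
    using S by (simp only: G_assoc W_row' simp_thms cong: ball_cong) blast
  note rec = recursion_pair[OF shifts init w_carrier w_eq[folded G_def] x_eq' S' L W X Cperp]
  have iN: "i \<le> N" and iN': "i - 1 \<le> N" and i0: "0 < i" using i by auto
  obtain P where pair: "lyapunov_sylvester_pair n q E Ahat G Chat Zhat r (W i) (X i) (S i) (L i) P"
    and cp: "char_poly (map_mat complex_of_real (- S i)) = (\<Prod>z\<in>#(\<Sum>k=1..i. block_shifts (\<alpha> k)). [:- z, 1:] ^ q)"
    and LX: "L i * X i = concat_cols q (map (\<lambda>k. l_w q (\<alpha> k) * x k) [1..<Suc i])"
    and xi: "x i \<in> carrier_mat (dim_row (s_w q (\<alpha> i))) (dim_row (s_w q (\<alpha> i)))"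
    and WXW: "W i * X i * (W i)\<^sup>T = W (i-1) * X (i-1) * (W (i-1))\<^sup>T + w i * x i * (w i)\<^sup>T"
    using rec[OF iN] i0 unfolding r by auto
  \<comment> \<open>The previous pair supplies the sizes for the gain update; for
    \<open>i = 1\<close> it is the empty pair.\<close>
  obtain P' where pair': "lyapunov_sylvester_pair n q E Ahat G Chat Zhat (dim_col (W (i-1))) (W (i-1)) (X (i-1)) (S (i-1)) (L (i-1)) P'"
    using rec[OF iN'] by blast
  interpret prev: lyapunov_sylvester_pair n q E Ahat G Chat Zhat "dim_col (W (i-1))" "W (i-1)" "X (i-1)" "S (i-1)" "L (i-1)" P'
    by (rule pair')
  interpret pair: lyapunov_sylvester_pair n q E Ahat G Chat Zhat r "W i" "X i" "S i" "L i" P by (rule pair)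
  interpret proj: projected_pair n q E Ahat G Chat Zhat r "W i" "X i" "S i" "L i" P V
    by unfold_locales (fact V match[unfolded Chat_r])+
  note dV = carrier_matD[OF V(1)] pair.dims
  have G_W: "(W i)\<^sup>T * Bhat * minv Rhat * Bhat\<^sup>T = (W i)\<^sup>T * G"
    by (rule G_assoc) (simp add: dV)
  have Br: "Bhat_r * minv Rhat * Bhat_r\<^sup>T = (W i)\<^sup>T * G * W i"
  proof -
    have "Bhat_r * minv Rhat * Bhat_r\<^sup>T = (W i)\<^sup>T * Bhat * minv Rhat * (Bhat\<^sup>T * W i)"
      unfolding Bhat_r using carrier_matD[OF Bhat_c] dV by (simp add: mat_transpose_mult_dim)
    also have "\<dots> = (W i)\<^sup>T * Bhat * minv Rhat * Bhat\<^sup>T * W i"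
      using carrier_matD[OF Bhat_c] carrier_matD[OF Rhat_c] dV by (simp add: mat_mult_assoc_dim)
    finally show ?thesis unfolding G_W .
  qed
  have minv_X: "minv (X i) = P" by (rule minv_eq[OF pair.X pair.P pair.XP pair.PX])
  have Chat_r_split: "Chat_r = C1_r @\<^sub>r C2_r"
    unfolding Chat_r C1_r C2_r Chat by (rule append_rows_mult[OF C1 C2 V(1)])
  have Bhat_r_split: "Bhat_r = append_cols B1_r B2_r"
    unfolding Bhat_r B1_r B2_r Bhat using pair.W by (intro mult_append_cols[OF _ B1 B2]) simp
  have Ahat_r_eq: "Ahat_r = (S i)\<^sup>T - (L i)\<^sup>T * Zhat * Chat_r"
    unfolding Ahat_r proj.projected_A match by (simp add: mat_mult_assoc_dim dV)
  have setting: "Ahat\<^sup>T * W i - E\<^sup>T * W i * S i + Chat\<^sup>T * Zhat * L i = 0\<^sub>m n r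
      \<and> invertible_mat (X i)
      \<and> - ((S i)\<^sup>T * minv (X i)) - minv (X i) * S i + (L i)\<^sup>T * Zhat * L i
          + (W i)\<^sup>T * Bhat * minv Rhat * Bhat\<^sup>T * W i = 0\<^sub>m r r
      \<and> Bhat_r = append_cols B1_r B2_r
      \<and> Chat_r = C1_r @\<^sub>r C2_r
      \<and> Ahat_r = (S i)\<^sup>T - (L i)\<^sup>T * Zhat * Chat_r
      \<and> L i * X i = concat_cols q (map (\<lambda>j. l_w q (\<alpha> j) * x j) [1..<Suc i])"
    unfolding minv_X G_W
    by (intro conjI pair.sylvester pair.lyapunov invertible_matI[OF pair.X pair.P pair.XP pair.PX]
        Bhat_r_split Chat_r_split Ahat_r_eq LX)
  have XBr: "X i * Bhat_r * minv Rhat * Bhat_r\<^sup>T = X i * (W i)\<^sup>T * G * W i"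
  proof -
    have "X i * Bhat_r * minv Rhat * Bhat_r\<^sup>T = X i * (Bhat_r * minv Rhat * Bhat_r\<^sup>T)"
      unfolding Bhat_r using carrier_matD[OF Bhat_c] carrier_matD[OF Rhat_c] dV by (simp add: mat_mult_assoc_dim)
    then show ?thesis unfolding Br by (simp add: mat_mult_assoc_dim dV)
  qed
  have riccati: "Ahat_r\<^sup>T * X i + X i * Ahat_r - X i * Bhat_r * minv Rhat * Bhat_r\<^sup>T * X i
          + Chat_r\<^sup>T * Zhat * Chat_r = 0\<^sub>m r r"
    unfolding XBr unfolding Ahat_r Chat_r by (rule proj.projected_riccati)
  have Acl': "Acl = (W i)\<^sup>T * Ahat * V - (W i)\<^sup>T * G * W i * X i"
    unfolding Acl Br unfolding Ahat_r ..
  have Acl_c: "Acl \<in> carrier_mat r r"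
    unfolding Acl' using pair.W pair.X V(1) Ahat_c G_c by auto
  \<comment> \<open>The similarity holds over the reals; the equality is then carried to the
    complexification by the embedding of coefficients.\<close>
  have "char_poly Acl = char_poly (- S i)"
    unfolding Acl' by (rule char_poly_similar[OF proj.closed_loop_similar])
  then have cp_Acl: "char_poly (map_mat complex_of_real Acl) = (\<Prod>z\<in>#(\<Sum>k=1..i. block_shifts (\<alpha> k)). [:- z, 1:] ^ q)"
    unfolding cp[symmetric] of_real_hom.char_poly_hom[OF Acl_c]
    using of_real_hom.char_poly_hom[of "- S i" r, where 'a = complex] pair.S by simp
  note spec = spectrum_char_poly_prod[OF Acl_c q(2) cp_Acl]
  have "\<forall>j\<in>{1..i}. Re (\<alpha> j) < 0" using shifts iN by simp
  then have hurwitz: "hurwitz Acl"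
    unfolding hurwitz_def spec(2) using block_shifts_sum_Re by blast
  \<comment> \<open>Expanding \<open>Ahat\<close> and \<open>G\<close>, the correction of
    \<open>Ahat\<close> by \<open>C2\<close> and the \<open>B1\<close> part of \<open>G\<close>
    combine into the \<open>R1\<close> term.\<close>
  have Acl_eq: "Acl = A_r + B2_r * minv R2 * B2_r\<^sup>T * X i
               - B1_r * minv R1 * (B1_r\<^sup>T * X i + C2_r)" (is "_ = ?R")
  proof (rule mat_entries_eqI)
    fix a b assume "a < dim_row ?R" "b < dim_col ?R"
    then show "Acl $$ (a, b) = ?R $$ (a, b)"
      unfolding Acl' Ahat_eq G_eq A_r B1_r B2_r C2_r
      by (simp add: mat_algebra d dV del: index_mult_mat(1))
  qed (simp_all add: Acl' A_r B1_r B2_r C2_r d dV)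
  have part1: "Ahat_r\<^sup>T * X i + X i * Ahat_r - X i * Bhat_r * minv Rhat * Bhat_r\<^sup>T * X i
          + Chat_r\<^sup>T * Zhat * Chat_r = 0\<^sub>m r r
      \<and> hurwitz Acl
      \<and> Acl = A_r + B2_r * minv R2 * B2_r\<^sup>T * X i
               - B1_r * minv R1 * (B1_r\<^sup>T * X i + C2_r)
      \<and> complex_spectrum Acl = set_mset (\<Sum>j=1..i. block_shifts (\<alpha> j))
      \<and> (\<forall>z. alg_mult Acl z = (p + m1) * count (\<Sum>j=1..i. block_shifts (\<alpha> j)) z)"
    using riccati hurwitz Acl_eq spec unfolding q(1) by blast
  have Xhat_i: "Xhat i = W i * X i * (W i)\<^sup>T" and Xhat_p: "Xhat (i-1) = W (i-1) * X (i-1) * (W (i-1))\<^sup>T"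
    and Xhat_0: "Xhat 0 = 0\<^sub>m n n"
    using Xhat iN by (auto simp: init)
  have Cp: "Cperp i = Chat - L i * X i * (W i)\<^sup>T * E" using Cperp i by blast
  have XG: "E\<^sup>T * Xhat i * Bhat * minv Rhat * Bhat\<^sup>T = E\<^sup>T * Xhat i * G"
    unfolding G_def Xhat_i using carrier_matD[OF Bhat_c] carrier_matD[OF Rhat_c] dV
    by (simp add: mat_mult_assoc_dim)
  have R_s_eq: "R_s = (Cperp i)\<^sup>T * Zhat * Cperp i"
    unfolding R_s XG unfolding Xhat_i Cp by (rule pair.residual_factorization)
  \<comment> \<open>The factorization moves \<open>V\<close> onto both defect factors, each of which
    it annihilates.\<close>
  have "V\<^sup>T * R_s * V = (Cperp i * V)\<^sup>T * Zhat * (Cperp i * V)"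
    unfolding R_s_eq Cp using V(1) by (simp add: mat_mult_assoc_dim mat_transpose_mult_dim dV)
  also have "\<dots> = 0\<^sub>m r r"
    unfolding Cp proj.defect_V using Zhat_c by simp
  finally have part2: "V\<^sup>T * R_s * V = 0\<^sub>m r r \<and> R_s = (Cperp i)\<^sup>T * Zhat * Cperp i"
    using R_s_eq by blast
  have w: "w i \<in> carrier_mat n (dim_row (s_w q (\<alpha> i)))" using w_carrier i by blast
  have K_step: "K i = K (i-1) + ?R1i * (B1\<^sup>T * w i * x i * (w i)\<^sup>T * E)"
  proof -
    have K: "K i = gain E B1 C2 R1 (Xhat i)" "K (i-1) = gain E B1 C2 R1 (Xhat (i-1))"
      using K iN iN' by simp_all
    have "K i = K (i-1) + ?R1i * (B1\<^sup>T * (w i * x i * (w i)\<^sup>T) * E)"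
      unfolding K Xhat_i Xhat_p WXW
      by (rule gain_add[OF E B1 C2 I1(1)
            mult_carrier_mat[OF mult_carrier_mat[OF prev.W prev.X] transpose_carrier_mat[THEN iffD2, OF prev.W]]
            mult_carrier_mat[OF mult_carrier_mat[OF w xi] transpose_carrier_mat[THEN iffD2, OF w]]])
    also have "B1\<^sup>T * (w i * x i * (w i)\<^sup>T) * E = B1\<^sup>T * w i * x i * (w i)\<^sup>T * E"
      using d carrier_matD[OF w] carrier_matD[OF xi] by (simp add: mat_mult_assoc_dim)
    finally show ?thesis .
  qed
  have "K 0 = gain E B1 C2 R1 (Xhat 0)" using K by simp
  \<comment> \<open>\<open>Xhat 0\<close> is the \<open>n\<close> by \<open>n\<close> zero matrix, a
    product over an empty inner dimension.\<close>
  then have "K 0 = ?R1i * C2"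
    using B1 E C2 unfolding Xhat_0 gain_def by (simp add: mat_zero_mult_dim)
  with K_step have part3: "K i = K (i-1) + minv R1 * (B1\<^sup>T * w i * x i * (w i)\<^sup>T * E)
      \<and> K 0 = minv R1 * C2" by blast
  have part4: "Ahat\<^sup>T * W i - E\<^sup>T * W i * Ahat_r\<^sup>T + (Cperp i)\<^sup>T * Zhat * L i = 0\<^sub>m n r"
    unfolding Ahat_r Cp by (rule proj.projected_sylvester)
  show ?thesis
    by (intro conjI setting part1 part2 part3 part4)
qed

end
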